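(* Let $K$ be a compact space. Then the following conditions are equivalent: (1) $K$ is semi-Eberlein. (2) There exist a dense subset $D\subset K$, a bounded set $\mathcal{A}\subset\mathcal{C}(K)$ separating the points of $K$ and a retractional skeleton $\mathfrak{s}=(r_s)_{s\in\Gamma}$ on $K$ with $D\subset D(\mathfrak{s})$ such that (a) $\mathfrak{s}$ is $\mathcal{A}$-shrinking with respect to $D$, and (b) $\lim_{s\in\Gamma'}r_s(x)\in D$, for every $x\in D$ and every up-directed subset $\Gamma'$ of $\Gamma$. (3) There exist a dense set $D\subset K$, a countable family $\mathcal{A}$ of subsets of $B_{\mathcal{C}(K)}$ and a retractional skeleton $\mathfrak{s}=(r_s)_{s\in\Gamma}$ on $K$ with $D\subset D(\mathfrak{s})$ such that (a) for every $A\in\mathcal{A}$ there exists $\varepsilon_A>0$ such that $\mathfrak{s}$ is $(A,\varepsilon_A)$-shrinking with respect to $D$, (b) for every $\varepsilon>0$ we have $B_{\mathcal{C}(K)}=\bigcup\{A\in\mathcal{A}:\varepsilon_A<\varepsilon\}$, and (c) $\lim_{s\in\Gamma'}r_s(x)\in D$, for every $x\in D$ and every up-directed subset $\Gamma'$ of $\Gamma$.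
   Context: All topological spaces are Tychonoff (in particular Hausdorff). $\mathcal{C}(K)$ is the Banach space of real-valued continuous functions on $K$ with the supremum norm, and $B_{\mathcal{C}(K)}$ is its closed unit ball. For a set $I$, $c_0(I)=\{x\in\mathbb{R}^I : \forall \varepsilon>0,\ \{i\in I: |x(i)|>\varepsilon\}\text{ is finite}\}\subset\mathbb{R}^I$. A compact space $K$ is semi-Eberlein if there is a homeomorphic embedding $h:K\to\mathbb{R}^I$ (product topology), for some set $I$, such that $h^{-1}[c_0(I)]$ is dense in $K$. Up-directed means nonempty and any two elements have an upper bound. An up-directed partially ordered set $\Gamma$ is $\sigma$-complete if every increasing sequence $(s_n)_{n\in\omega}$ ($s_n\le s_{n+1}$) has a supremum in $\Gamma$. A retractional skeleton on $K$ is a family $\mathfrak{s}=(r_s)_{s\in\Gamma}$ of continuous retractions on $K$ indexed by an up-directed $\sigma$-complete partially ordered set $\Gamma$ such that: (i) $r_s[K]$ is a metrizable compact space for each $s\in\Gamma$; (ii) if $s\le t$ then $r_s=r_t\circ r_s=r_s\circ r_t$; (iii) if $(s_n)_{n\in\omega}$ is increasing in $\Gamma$ and $s=\sup_n s_n$, then $r_s(x)=\lim_n r_{s_n}(x)$ for every $x\in K$; (iv) $x=\lim_{s\in\Gamma}r_s(x)$ for every $x\in K$. The set induced by $\mathfrak{s}$ is $D(\mathfrak{s})=\bigcup_{s\in\Gamma}r_s[K]$. For a nonempty bounded $\mathcal{A}\subset\mathcal{C}(K)$ put $\rho_{\mathcal{A}}(k,l)=\sup_{f\in\mathcal{A}}|f(k)-f(l)|$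 for $k,l\in K$. For $D\subset K$, the skeleton $\mathfrak{s}$ is $\mathcal{A}$-shrinking with respect to $D$ if for every $x\in D$ and every increasing sequence $(s_n)_{n\in\omega}$ in $\Gamma$ with $s=\sup_n s_n$ we have $\lim_n\rho_{\mathcal{A}}(r_{s_n}(x),r_s(x))=0$. For $\varepsilon>0$, $\mathfrak{s}$ is $(\mathcal{A},\varepsilon)$-shrinking with respect to $D$ if for all such $x$, $(s_n)$, $s$ we have $\limsup_n\rho_{\mathcal{A}}(r_{s_n}(x),r_s(x))\le\varepsilon$. *)

theory Defs
  imports "HOL-Analysis.Analysis"
begin

section \<open>Semi-Eberlein compacta\<close>

definition c0 :: "'i set \<Rightarrow> ('i \<Rightarrow> real) set" where
  "c0 I = {x \<in> topspace (powertop_real I). \<forall>e>0. finite {i \<in> I. \<bar>x i\<bar> > e}}"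

text \<open>The compact space is (the whole of) the type \<open>'a\<close>; the index set \<open>I\<close> ranges over the
  subsets of the type \<open>'i\<close>.\<close>

definition semi_Eberlein :: "'i itself \<Rightarrow> 'a::topological_space itself \<Rightarrow> bool" where
  "semi_Eberlein TYPE('i) TYPE('a) \<longleftrightarrow>
     (\<exists>(I :: 'i set) (h :: 'a \<Rightarrow> 'i \<Rightarrow> real).
        embedding_map euclidean (powertop_real I) h \<and> closure (h -` c0 I) = UNIV)"


section \<open>Directed sets\<close>

text \<open>A partially ordered set is given as a carrier \<open>\<Gamma>\<close> together with a relation \<open>le\<close>
  satisfying \<open>partial_order_on \<Gamma> le\<close>, where \<open>(s, t) \<in> le\<close> means \<open>s \<le> t\<close>.\<close>

definition up_directed :: "'g set \<Rightarrow> 'g rel \<Rightarrow> bool" where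
  "up_directed \<Gamma> le \<longleftrightarrow>
     \<Gamma> \<noteq> {} \<and> (\<forall>s\<in>\<Gamma>. \<forall>t\<in>\<Gamma>. \<exists>u\<in>\<Gamma>. (s, u) \<in> le \<and> (t, u) \<in> le)"

definition increasing_in :: "'g set \<Rightarrow> 'g rel \<Rightarrow> (nat \<Rightarrow> 'g) \<Rightarrow> bool" where
  "increasing_in \<Gamma> le \<sigma> \<longleftrightarrow> (\<forall>n. \<sigma> n \<in> \<Gamma> \<and> (\<sigma> n, \<sigma> (Suc n)) \<in> le)"

definition is_supremum :: "'g set \<Rightarrow> 'g rel \<Rightarrow> 'g set \<Rightarrow> 'g \<Rightarrow> bool" where
  "is_supremum \<Gamma> le S s \<longleftrightarrow>
     s \<in> \<Gamma> \<and> (\<forall>t\<in>S. (t, s) \<in> le) \<and>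
     (\<forall>u\<in>\<Gamma>. (\<forall>t\<in>S. (t, u) \<in> le) \<longrightarrow> (s, u) \<in> le)"

definition sigma_complete :: "'g set \<Rightarrow> 'g rel \<Rightarrow> bool" where
  "sigma_complete \<Gamma> le \<longleftrightarrow>
     (\<forall>\<sigma>. increasing_in \<Gamma> le \<sigma> \<longrightarrow> (\<exists>s. is_supremum \<Gamma> le (range \<sigma>) s))"

text \<open>The filter of tails of \<open>\<Gamma>\<close>: for up-directed \<open>\<Gamma>\<close>, the limit of a net along \<open>\<Gamma>\<close> is its
  limit with respect to this filter.\<close>

definition tails :: "'g set \<Rightarrow> 'g rel \<Rightarrow> 'g filter" where
  "tails \<Gamma> le = (INF s\<in>\<Gamma>. principal {t \<in> \<Gamma>. (s, t) \<in> le})"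


section \<open>Retractional skeletons\<close>

definition retractional_skeleton ::
    "'g set \<Rightarrow> 'g rel \<Rightarrow> ('g \<Rightarrow> 'a::topological_space \<Rightarrow> 'a) \<Rightarrow> bool" where
  "retractional_skeleton \<Gamma> le r \<longleftrightarrow>
     partial_order_on \<Gamma> le \<and> up_directed \<Gamma> le \<and> sigma_complete \<Gamma> le \<and>
     (\<forall>s\<in>\<Gamma>. retraction UNIV (range (r s)) (r s)) \<and>
     (\<forall>s\<in>\<Gamma>. compact (range (r s)) \<and> metrizable_space (top_of_set (range (r s)))) \<and>
     (\<forall>s\<in>\<Gamma>. \<forall>t\<in>\<Gamma>. (s, t) \<in> le \<longrightarrow> r s = r t \<circ> r s \<and> r s = r s \<circ> r t) \<and>
     (\<forall>\<sigma> s. increasing_in \<Gamma> le \<sigma> \<longrightarrow> is_supremum \<Gamma> le (range \<sigma>) s \<longrightarrow>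
        (\<forall>x. (\<lambda>n. r (\<sigma> n) x) \<longlonglongrightarrow> r s x)) \<and>
     (\<forall>x. ((\<lambda>s. r s x) \<longlongrightarrow> x) (tails \<Gamma> le))"

definition induced_set :: "'g set \<Rightarrow> ('g \<Rightarrow> 'a \<Rightarrow> 'a) \<Rightarrow> 'a set" where
  "induced_set \<Gamma> r = (\<Union>s\<in>\<Gamma>. range (r s))"


section \<open>Shrinking skeletons\<close>

text \<open>For compact \<open>'a\<close> every continuous real function is bounded, so \<open>'a \<Rightarrow>\<^sub>C real\<close> is the Banach
  space of all continuous functions on \<open>'a\<close> with the supremum norm. The following notions are
  only meaningful for nonempty bounded \<open>A\<close>.\<close>

definition rho :: "('a::topological_space \<Rightarrow>\<^sub>C real) set \<Rightarrow> 'a \<Rightarrow> 'a \<Rightarrow> real" where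
  "rho A k l = (SUP f\<in>A. \<bar>apply_bcontfun f k - apply_bcontfun f l\<bar>)"

definition separates_points :: "('a::topological_space \<Rightarrow>\<^sub>C real) set \<Rightarrow> bool" where
  "separates_points A \<longleftrightarrow>
     (\<forall>k l. k \<noteq> l \<longrightarrow> (\<exists>f\<in>A. apply_bcontfun f k \<noteq> apply_bcontfun f l))"

definition shrinking ::
    "('a::topological_space \<Rightarrow>\<^sub>C real) set \<Rightarrow> 'a set \<Rightarrow> 'g set \<Rightarrow> 'g rel \<Rightarrow> ('g \<Rightarrow> 'a \<Rightarrow> 'a) \<Rightarrow> bool" where
  "shrinking A D \<Gamma> le r \<longleftrightarrow>
     (\<forall>x\<in>D. \<forall>\<sigma> s. increasing_in \<Gamma> le \<sigma> \<longrightarrow> is_supremum \<Gamma> le (range \<sigma>) s \<longrightarrow>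
        (\<lambda>n. rho A (r (\<sigma> n) x) (r s x)) \<longlonglongrightarrow> 0)"

definition eps_shrinking ::
    "('a::topological_space \<Rightarrow>\<^sub>C real) set \<Rightarrow> real \<Rightarrow> 'a set \<Rightarrow> 'g set \<Rightarrow> 'g rel \<Rightarrow> ('g \<Rightarrow> 'a \<Rightarrow> 'a) \<Rightarrow> bool" where
  "eps_shrinking A \<epsilon> D \<Gamma> le r \<longleftrightarrow>
     (\<forall>x\<in>D. \<forall>\<sigma> s. increasing_in \<Gamma> le \<sigma> \<longrightarrow> is_supremum \<Gamma> le (range \<sigma>) s \<longrightarrow>
        limsup (\<lambda>n. ereal (rho A (r (\<sigma> n) x) (r s x))) \<le> ereal \<epsilon>)"

text \<open>For every \<open>x \<in> D\<close> and every up-directed \<open>\<Gamma>' \<subseteq> \<Gamma>\<close> the limit of \<open>r s x\<close> along \<open>\<Gamma>'\<close> exists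
  and lies in \<open>D\<close> (limits are unique, the spaces being Hausdorff).\<close>

definition closed_under_limits ::
    "'a::topological_space set \<Rightarrow> 'g set \<Rightarrow> 'g rel \<Rightarrow> ('g \<Rightarrow> 'a \<Rightarrow> 'a) \<Rightarrow> bool" where
  "closed_under_limits D \<Gamma> le r \<longleftrightarrow>
     (\<forall>x\<in>D. \<forall>\<Gamma>'\<subseteq>\<Gamma>. up_directed \<Gamma>' le \<longrightarrow>
        (\<exists>l\<in>D. ((\<lambda>s. r s x) \<longlongrightarrow> l) (tails \<Gamma>' le)))"


section \<open>Universes for the index sets\<close>

text \<open>Existential quantification over arbitrary sets \<open>I\<close> and \<open>\<Gamma>\<close> has to be bounded by a type. The
  following types are large enough to lose nothing: every embedding into \<open>\<real>\<^sup>I\<close> can be indexed by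
  its distinct coordinate functions, and a skeleton obtained from it by countable sets of
  coordinates. The type variables \<open>'i\<close> and \<open>'g\<close> are arbitrary, so index sets over any other type
  are covered as well.\<close>

type_synonym ('a, 'i) coord_index = "('a \<Rightarrow> real) + 'i"
type_synonym ('a, 'g) skeleton_index = "('a \<Rightarrow> real) set + 'g"

end

(* The arrow from semi-Eberlein to (2) uses the skeleton of projections onto suitable countable sets
   of coordinates. From (2) to (3), functions that are Lipschitz for the pseudometric of the bounded
   separating set form an algebra, so by Stone-Weierstrass they are dense, and the sets of functions
   1/n-close to an m-Lipschitz one are as small as needed.

   For the converse, an up-directed set M of indices has a limit retraction R M, continuous because
   increasing sequences of indices have suprema along which the skeleton converges. By induction on
   the cardinality of M one builds bounded continuous functions that separate the points separated by
   M and lie in c_0 at each point of D. An uncountable M is a continuous increasing chain of up-directed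
   sets of smaller cardinality; for consecutive members L and H of the chain one takes the functions
   f o R H - f o R L, with f in the family of H, cut off near 0 at a level adapted to the shrinking
   constant of f. If infinitely many jumps were above that level at a point of D, an increasing
   sequence of indices running through them would contradict shrinking. *)
theory Submission
  imports Defs "HOL-Library.Countable_Set_Type"
begin

section \<open>Compactness and nets\<close>

text \<open>Only increasing sequences of indices are known to have suprema, so an uncountable
  directed set may have no single index that stands for it; \<open>limit_retraction M\<close>
  replaces the missing retraction. Shrinking with a positive constant \<epsilon> controls only jumps
  larger than 2 \<epsilon>, so plain differences between consecutive stages need not be in c_0. Each
  difference is cut off at every level 1 / (n + 1) that exceeds twice the constant of some set
  containing the function, and is weighted by a power of 1/2 depending on the level and on the
  number of that set. Countability of the cover makes these weights available, and the arbitrarily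
  small constants ensure that no difference is lost. Since D is closed under limits, the functions
  of a stage are evaluated at points that again lie in D. In the other direction the obstacle is
  that putting the coordinates outside a countable set to 0 may lead out of the space. Closing off
  against the dense set of c_0 points gives enough coordinate sets for which it does not.\<close>

lemma compact_cluster_point:
  fixes F :: "'a::topological_space filter"
  assumes "compact (UNIV :: 'a set)" and "F \<noteq> bot"
  obtains w where "\<And>C. closed C \<Longrightarrow> eventually (\<lambda>x. x \<in> C) F \<Longrightarrow> w \<in> C"
proof -
  obtain w where w: "inf (nhds w) F \<noteq> bot"
    using assms unfolding compact_filter by auto
  have "w \<in> C" if "closed C" "eventually (\<lambda>x. x \<in> C) F" for C
  proof (rule ccontr)
    assume "w \<notin> C"
    then have "eventually (\<lambda>x. x \<in> - C) (nhds w)"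
      using that by (auto simp: eventually_nhds)
    then have "eventually (\<lambda>x. x \<in> - C) (inf (nhds w) F)" "eventually (\<lambda>x. x \<in> C) (inf (nhds w) F)"
      using that by (auto intro: filter_leD[OF inf_le1] filter_leD[OF inf_le2])
    then have "eventually (\<lambda>x. False) (inf (nhds w) F)"
      by eventually_elim auto
    with w show False
      by (simp add: eventually_False)
  qed
  then show thesis
    by (rule that)
qed

lemma compact_net_cluster_point:
  fixes y :: "'b \<Rightarrow> 'a::topological_space"
  assumes "compact (UNIV :: 'a set)" and "G \<noteq> bot"
  obtains w where "\<And>C. closed C \<Longrightarrow> eventually (\<lambda>s. y s \<in> C) G \<Longrightarrow> w \<in> C"
proof -
  have "filtermap y G \<noteq> bot"
    using assms by (simp add: filtermap_bot_iff)
  from compact_cluster_point[OF assms(1) this] obtain w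
    where "\<And>C. closed C \<Longrightarrow> eventually (\<lambda>x. x \<in> C) (filtermap y G) \<Longrightarrow> w \<in> C"
    by blast
  then show thesis
    by (intro that) (simp add: eventually_filtermap)
qed

lemma LIMSEQ_in_closed:
  assumes "closed C" and "\<And>n. f n \<in> C" and "f \<longlonglongrightarrow> l"
  shows "l \<in> C"
  by (rule Lim_in_closed_set[OF assms(1) _ sequentially_bot assms(3)]) (simp add: assms(2))

text \<open>If the net frequently left a neighbourhood \<open>U\<close> of \<open>l\<close>, the
  filter restricted to those indices would have a cluster point outside \<open>U\<close>. The
  hypothesis \<open>uniq\<close> ranges over all finer filters \<open>H\<close> in order to cover
  this restricted one.\<close>

lemma compact_net_tendsto:
  fixes y :: "'b \<Rightarrow> 'a::topological_space"
  assumes "compact (UNIV :: 'a set)"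
    and uniq: "\<And>H w. \<lbrakk>H \<noteq> bot; H \<le> G; \<And>C. closed C \<Longrightarrow> eventually (\<lambda>s. y s \<in> C) H \<Longrightarrow> w \<in> C\<rbrakk> \<Longrightarrow> w = l"
  shows "(y \<longlongrightarrow> l) G"
proof (rule topological_tendstoI, rule ccontr)
  fix U assume U: "open U" "l \<in> U" and "\<not> eventually (\<lambda>s. y s \<in> U) G"
  define H where "H = inf G (principal {s. y s \<notin> U})"
  have "H \<noteq> bot"
    using \<open>\<not> eventually _ G\<close> by (simp add: H_def trivial_limit_def eventually_inf_principal)
  then obtain w where w: "\<And>C. closed C \<Longrightarrow> eventually (\<lambda>s. y s \<in> C) H \<Longrightarrow> w \<in> C"
    using compact_net_cluster_point[OF assms(1), where y = y] by blast
  have "w = l"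
    using \<open>H \<noteq> bot\<close> w by (intro uniq) (auto simp: H_def)
  moreover have "w \<in> - U"
    using U by (intro w) (auto simp: H_def eventually_inf_principal)
  ultimately show False
    using U by simp
qed

text \<open>A map into a compact space is continuous if its graph is closed. The graph is given by
  equations between continuous functions and a closed set, the form in which
  \<open>limit_retraction\<close> is characterised.\<close>

lemma compact_closed_graph_imp_continuous:
  fixes f :: "'a::topological_space \<Rightarrow> 'a"
  assumes "compact (UNIV :: 'a set)"
    and graph: "\<And>x y. y = f x \<longleftrightarrow> (\<forall>i\<in>I. g i x = h i y) \<and> y \<in> T"
    and "\<And>i. i \<in> I \<Longrightarrow> continuous_on UNIV (g i :: 'a \<Rightarrow> 'b::t2_space)"
    and "\<And>i. i \<in> I \<Longrightarrow> continuous_on UNIV (h i)" and "closed T"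
  shows "continuous_on UNIV f"
proof -
  have "(f \<longlongrightarrow> f x) (at x)" for x
  proof (rule compact_net_tendsto[OF assms(1)])
    fix H w
    assume H: "H \<noteq> bot" "H \<le> at x"
      and w: "\<And>C. closed C \<Longrightarrow> eventually (\<lambda>s. f s \<in> C) H \<Longrightarrow> w \<in> C"
    have "w \<in> T"
      using graph \<open>closed T\<close> by (intro w always_eventually) blast+
    moreover have "g i x = h i w" if i: "i \<in> I" for i
    proof (rule ccontr)
      assume "g i x \<noteq> h i w"
      then obtain U V where UV: "open U" "open V" "g i x \<in> U" "h i w \<in> V" "U \<inter> V = {}"
        by (meson hausdorff)
      have "(g i \<longlongrightarrow> g i x) (at x)"
        using assms(3)[OF i] by (simp add: continuous_on_def)
      then have "eventually (\<lambda>s. g i s \<in> U) H"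
        using UV by (intro filter_leD[OF H(2)] topological_tendstoD)
      moreover have "g i s = h i (f s)" for s
        using graph i by blast
      ultimately have "eventually (\<lambda>s. f s \<in> h i -` (- V)) H"
        using UV by (auto elim: eventually_mono)
      moreover have "closed (h i -` (- V))"
        using UV assms(4)[OF i] by (auto simp: continuous_on_closed_vimage)
      ultimately show False
        using w UV by blast
    qed
    ultimately show "w = f x"
      using graph by blast
  qed
  then show ?thesis
    by (simp add: continuous_on_def)
qed

lemma Hausdorff_space_euclidean_t2: "Hausdorff_space (euclidean :: 'a::t2_space topology)"
  unfolding Hausdorff_space_def disjnt_def using hausdorff by auto

lemma compact_t2_separate_closures:
  fixes x y :: "'a::t2_space"
  assumes "compact (UNIV :: 'a set)" and "x \<noteq> y"
  obtains U V where "open U" "open V" "x \<in> U" "y \<in> V" "closure U \<inter> closure V = {}"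
proof -
  have "normal_space (euclidean :: 'a topology)"
    using assms(1) by (intro compact_Hausdorff_or_regular_imp_normal_space)
      (auto simp: compact_space_def Hausdorff_space_euclidean_t2)
  moreover have "closedin euclidean {x}" "closedin euclidean {y}" "disjnt {x} {y}"
    using assms(2) by auto
  ultimately obtain f where "continuous_map euclidean euclideanreal f" "f ` {x} \<subseteq> {0}" "f ` {y} \<subseteq> {1}"
    by (rule Urysohn_lemma_alt[where a = 0 and b = 1])
  then have f: "continuous_on UNIV (f :: 'a \<Rightarrow> real)" "f x = 0" "f y = 1"
    by auto
  show thesis
  proof
    show "open (f -` {..<1/3})" "open (f -` {2/3<..})"
      using f(1) by (auto intro!: open_vimage)
    show "x \<in> f -` {..<1/3}" "y \<in> f -` {2/3<..}"
      using f by auto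
    have "closure (f -` {..<1/3}) \<subseteq> f -` {..1/3}" "closure (f -` {2/3<..}) \<subseteq> f -` {2/3..}"
      using f(1) by (intro closure_minimal closed_vimage; auto)+
    then show "closure (f -` {..<1/3}) \<inter> closure (f -` {2/3<..}) = {}"
      by fastforce
  qed
qed

text \<open>No point with the values \<open>c f\<close> is assumed to exist: a cluster point
  supplied by compactness realises them, and separation makes it the only one. Points with
  prescribed coordinates are obtained in this way.\<close>

lemma tendsto_of_separating_family:
  fixes y :: "'b \<Rightarrow> 'a::t2_space"
  assumes "compact (UNIV :: 'a set)" and "G \<noteq> bot"
    and cont: "\<And>f. f \<in> F \<Longrightarrow> continuous_on UNIV (f :: 'a \<Rightarrow> real)"
    and sep: "\<And>x z. x \<noteq> z \<Longrightarrow> \<exists>f\<in>F. f x \<noteq> f z"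
    and lim: "\<And>f. f \<in> F \<Longrightarrow> ((\<lambda>s. f (y s)) \<longlongrightarrow> c f) G"
  obtains l where "(y \<longlongrightarrow> l) G" "\<And>f. f \<in> F \<Longrightarrow> f l = c f"
proof -
  have val: "f w = c f" if H: "H \<le> G" and f: "f \<in> F"
    and w: "\<And>C. closed C \<Longrightarrow> eventually (\<lambda>s. y s \<in> C) H \<Longrightarrow> w \<in> C" for H w f
  proof -
    have "\<bar>f w - c f\<bar> \<le> e" if "e > 0" for e
    proof -
      have "eventually (\<lambda>s. dist (f (y s)) (c f) < e) H"
        using lim[OF f] that by (intro filter_leD[OF H] tendstoD)
      then have "eventually (\<lambda>s. y s \<in> {x. \<bar>f x - c f\<bar> \<le> e}) H"
        by eventually_elim (auto simp: dist_real_def)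
      moreover have "closed {x. \<bar>f x - c f\<bar> \<le> e}"
        using cont[OF f] by (intro closed_Collect_le continuous_intros) auto
      ultimately show ?thesis
        using w by blast
    qed
    then have "\<bar>f w - c f\<bar> \<le> 0"
      by (rule field_le_epsilon) simp
    then show ?thesis
      by simp
  qed
  obtain l where l: "\<And>C. closed C \<Longrightarrow> eventually (\<lambda>s. y s \<in> C) G \<Longrightarrow> l \<in> C"
    using compact_net_cluster_point[OF assms(1,2)] by blast
  have "(y \<longlongrightarrow> l) G"
  proof (rule compact_net_tendsto[OF assms(1)])
    fix H w
    assume "H \<noteq> bot" "H \<le> G" "\<And>C. closed C \<Longrightarrow> eventually (\<lambda>s. y s \<in> C) H \<Longrightarrow> w \<in> C"
    then have "f w = f l" if "f \<in> F" for f
      using val[OF _ that] l that by (metis order_refl)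
    then show "w = l"
      using sep by blast
  qed
  then show thesis
    using that val l by blast
qed

section \<open>Limits of a skeleton along directed sets\<close>

lemma eventually_tails:
  assumes "up_directed M le" "trans le"
  shows "eventually P (tails M le) \<longleftrightarrow> (\<exists>s\<in>M. \<forall>t\<in>M. (s, t) \<in> le \<longrightarrow> P t)"
  unfolding tails_def
proof (subst eventually_INF_base)
  show "M \<noteq> {}"
    using assms by (simp add: up_directed_def)
  fix a b assume "a \<in> M" "b \<in> M"
  then obtain u where "u \<in> M" "(a, u) \<in> le" "(b, u) \<in> le"
    using assms by (auto simp: up_directed_def)
  then show "\<exists>x\<in>M. principal {t \<in> M. (x, t) \<in> le} \<le> inf (principal {t \<in> M. (a, t) \<in> le}) (principal {t \<in> M. (b, t) \<in> le})"
    using \<open>trans le\<close> by (intro bexI[of _ u]) (auto dest: transD)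
qed (auto simp: eventually_principal)

lemma tails_nontrivial:
  assumes "up_directed M le" "trans le"
  shows "tails M le \<noteq> bot"
  using assms(1) by (auto simp: trivial_limit_def eventually_tails[OF assms] up_directed_def) 

locale skeleton =
  fixes \<Gamma> :: "'g set" and le :: "'g rel" and r :: "'g \<Rightarrow> 'a::t2_space \<Rightarrow> 'a"
  assumes compact_UNIV: "compact (UNIV :: 'a set)"
    and skeleton: "retractional_skeleton \<Gamma> le r"
begin

lemma trans_le: "trans le" and refl_le: "s \<in> \<Gamma> \<Longrightarrow> (s, s) \<in> le"
  using skeleton
  by (auto simp: retractional_skeleton_def partial_order_on_def preorder_on_def refl_on_def)

lemma le_trans: "(s, t) \<in> le \<Longrightarrow> (t, u) \<in> le \<Longrightarrow> (s, u) \<in> le"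
  using trans_le by (rule transD)

lemma up_directed_carrier: "up_directed \<Gamma> le"
  using skeleton by (auto simp: retractional_skeleton_def)

lemma continuous_r: "s \<in> \<Gamma> \<Longrightarrow> continuous_on UNIV (r s)"
  using skeleton by (auto simp: retractional_skeleton_def retraction_def)

lemma closed_range_r: "s \<in> \<Gamma> \<Longrightarrow> closed (range (r s))"
  using skeleton by (auto simp: retractional_skeleton_def compact_imp_closed)

lemma metrizable_range_r: "s \<in> \<Gamma> \<Longrightarrow> metrizable_space (top_of_set (range (r s)))"
  using skeleton by (auto simp: retractional_skeleton_def)

lemma r_r:
  assumes "s \<in> \<Gamma>" "t \<in> \<Gamma>" "(s, t) \<in> le"
  shows "r t (r s x) = r s x" "r s (r t x) = r s x"
  using skeleton assms unfolding retractional_skeleton_def by (metis comp_apply)+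

lemma range_r_mono: "s \<in> \<Gamma> \<Longrightarrow> t \<in> \<Gamma> \<Longrightarrow> (s, t) \<in> le \<Longrightarrow> range (r s) \<subseteq> range (r t)"
  using r_r(1) by (metis image_subsetI rangeI)

lemma increasing_sup:
  assumes "increasing_in \<Gamma> le \<sigma>"
  obtains s where "is_supremum \<Gamma> le (range \<sigma>) s" "s \<in> \<Gamma>" "\<And>n. (\<sigma> n, s) \<in> le"
    "\<And>x. (\<lambda>n. r (\<sigma> n) x) \<longlonglongrightarrow> r s x"
proof -
  obtain s where s: "is_supremum \<Gamma> le (range \<sigma>) s"
    using skeleton assms by (auto simp: retractional_skeleton_def sigma_complete_def)
  moreover have "(\<lambda>n. r (\<sigma> n) x) \<longlonglongrightarrow> r s x" for x
    using skeleton assms s by (auto simp: retractional_skeleton_def)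
  ultimately show thesis
    by (intro that) (auto simp: is_supremum_def)
qed

text \<open>Two distinct cluster points would be approached alternately along an increasing sequence
  of indices in \<open>M\<close>. Along it the skeleton converges to the retraction at the supremum,
  so the limit would lie in two disjoint closures. The supremum itself may lie outside
  \<open>M\<close>.\<close>

lemma ex_limit:
  assumes M: "M \<subseteq> \<Gamma>" "up_directed M le"
  shows "\<exists>l. ((\<lambda>s. r s x) \<longlongrightarrow> l) (tails M le)"
proof -
  note ev = eventually_tails[OF M(2) trans_le]
  obtain l where l: "\<And>C. closed C \<Longrightarrow> eventually (\<lambda>s. r s x \<in> C) (tails M le) \<Longrightarrow> l \<in> C"
    using compact_net_cluster_point[OF compact_UNIV tails_nontrivial[OF M(2) trans_le], where y = "\<lambda>s. r s x"]
    by blast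
  have "((\<lambda>s. r s x) \<longlongrightarrow> l) (tails M le)"
  proof (rule compact_net_tendsto[OF compact_UNIV], rule ccontr)
    fix H w
    assume H: "H \<noteq> bot" "H \<le> tails M le" and "w \<noteq> l"
      and w: "\<And>C. closed C \<Longrightarrow> eventually (\<lambda>s. r s x \<in> C) H \<Longrightarrow> w \<in> C"
    obtain U V where UV: "open U" "open V" "w \<in> U" "l \<in> V" "closure U \<inter> closure V = {}"
      using compact_t2_separate_closures[OF compact_UNIV \<open>w \<noteq> l\<close>] .
    have freqV: "\<exists>t\<in>M. (s, t) \<in> le \<and> r t x \<in> V" if "s \<in> M" for s
      using l[of "- V"] UV that by (auto simp: ev)
    have freqU: "\<exists>t\<in>M. (s, t) \<in> le \<and> r t x \<in> U" if "s \<in> M" for s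
    proof (rule ccontr)
      assume "\<not> ?thesis"
      then have "eventually (\<lambda>s. r s x \<in> - U) (tails M le)"
        using that by (auto simp: ev)
      then show False
        using w[of "- U"] UV H by (auto dest: filter_leD)
    qed
    obtain s0 where "s0 \<in> M" "r s0 x \<in> V"
      using freqV M(2) unfolding up_directed_def by blast
    then have "\<exists>\<sigma>. \<forall>n. (\<sigma> n \<in> M \<and> r (\<sigma> n) x \<in> (if even n then V else U)) \<and> (\<sigma> n, \<sigma> (Suc n)) \<in> le"
    proof (intro dependent_nat_choice)
      fix s and n :: nat assume "s \<in> M \<and> r s x \<in> (if even n then V else U)"
      then show "\<exists>t. (t \<in> M \<and> r t x \<in> (if even (Suc n) then V else U)) \<and> (s, t) \<in> le"
        using freqU[of s] freqV[of s] by (cases "even n") auto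
    qed auto
    then obtain \<sigma> where \<sigma>: "\<And>n. \<sigma> n \<in> M \<and> r (\<sigma> n) x \<in> (if even n then V else U)"
      "\<And>n. (\<sigma> n, \<sigma> (Suc n)) \<in> le"
      by blast
    have inc: "increasing_in \<Gamma> le \<sigma>"
      using \<sigma> M by (auto simp: increasing_in_def)
    obtain s where "s \<in> \<Gamma>" "\<And>n. (\<sigma> n, s) \<in> le"
      and s: "\<And>x. (\<lambda>n. r (\<sigma> n) x) \<longlonglongrightarrow> r s x"
      by (rule increasing_sup[OF inc]) blast
    have lim: "(\<lambda>n. r (\<sigma> (2 * n)) x) \<longlonglongrightarrow> r s x" "(\<lambda>n. r (\<sigma> (2 * n + 1)) x) \<longlonglongrightarrow> r s x"
      using LIMSEQ_subseq_LIMSEQ[OF s, of "\<lambda>n. 2 * n"] LIMSEQ_subseq_LIMSEQ[OF s, of "\<lambda>n. 2 * n + 1"]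
      by (simp_all add: comp_def strict_mono_def)
    have "r (\<sigma> (2 * n)) x \<in> closure V" "r (\<sigma> (2 * n + 1)) x \<in> closure U" for n
      using \<sigma>(1)[of "2 * n"] \<sigma>(1)[of "2 * n + 1"] closure_subset[of V] closure_subset[of U] by auto
    then have "r s x \<in> closure V" "r s x \<in> closure U"
      using LIMSEQ_in_closed[OF closed_closure _ lim(1)] LIMSEQ_in_closed[OF closed_closure _ lim(2)] by blast+
    then show False
      using UV by blast
  qed
  then show ?thesis
    by blast
qed

section \<open>Retractions attached to arbitrary up-directed sets of indices\<close>

definition limit_retraction :: "'g set \<Rightarrow> 'a \<Rightarrow> 'a" where
  "limit_retraction M x = Lim (tails M le) (\<lambda>s. r s x)"

lemma tendsto_limit_retraction:
  assumes M: "M \<subseteq> \<Gamma>" "up_directed M le"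
  shows "((\<lambda>s. r s x) \<longlongrightarrow> limit_retraction M x) (tails M le)"
  using ex_limit[OF M, of x] tendsto_Lim[OF tails_nontrivial[OF M(2) trans_le]]
  by (auto simp: limit_retraction_def)

lemma limit_retraction_eqI:
  assumes M: "M \<subseteq> \<Gamma>" "up_directed M le" and "((\<lambda>s. r s x) \<longlongrightarrow> l) (tails M le)"
  shows "limit_retraction M x = l"
  using tendsto_Lim[OF tails_nontrivial[OF M(2) trans_le] assms(3)] by (simp add: limit_retraction_def)

lemma r_limit_retraction:
  assumes M: "M \<subseteq> \<Gamma>" "up_directed M le" and s: "s \<in> M"
  shows "r s (limit_retraction M x) = r s x"
proof (rule tendsto_unique[OF tails_nontrivial[OF M(2) trans_le]])
  have "isCont (r s) (limit_retraction M x)"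
    using continuous_r s M by (auto simp: continuous_on_eq_continuous_at)
  then show "((\<lambda>t. r s (r t x)) \<longlongrightarrow> r s (limit_retraction M x)) (tails M le)"
    using tendsto_limit_retraction[OF M] by (rule isCont_tendsto_compose)
  show "((\<lambda>t. r s (r t x)) \<longlongrightarrow> r s x) (tails M le)"
    using s M(1) by (intro tendsto_eventually) (auto simp: eventually_tails[OF M(2) trans_le] r_r subset_iff intro!: bexI[of _ s])
qed

lemma limit_retraction_eq_iff:
  assumes M: "M \<subseteq> \<Gamma>" "up_directed M le"
  shows "limit_retraction M x = limit_retraction M y \<longleftrightarrow> (\<forall>s\<in>M. r s x = r s y)"
proof
  assume "limit_retraction M x = limit_retraction M y"
  then show "\<forall>s\<in>M. r s x = r s y"
    using r_limit_retraction[OF M] by metis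
next
  assume eq: "\<forall>s\<in>M. r s x = r s y"
  have "((\<lambda>s. r s y) \<longlongrightarrow> limit_retraction M x) (tails M le)"
    by (rule Lim_transform_eventually[OF tendsto_limit_retraction[OF M]])
      (use eq M(2) in \<open>auto simp: eventually_tails[OF M(2) trans_le] up_directed_def\<close>)
  then show "limit_retraction M x = limit_retraction M y"
    using limit_retraction_eqI[OF M] by metis
qed

lemma limit_retraction_in_closure:
  assumes M: "M \<subseteq> \<Gamma>" "up_directed M le"
  shows "limit_retraction M x \<in> closure (\<Union>s\<in>M. range (r s))"
proof (rule Lim_in_closed_set[OF closed_closure _ tails_nontrivial[OF M(2) trans_le] tendsto_limit_retraction[OF M]])
  show "eventually (\<lambda>s. r s x \<in> closure (\<Union>s\<in>M. range (r s))) (tails M le)"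
    using M(2) closure_subset[of "\<Union>s\<in>M. range (r s)"]
    unfolding eventually_tails[OF M(2) trans_le] up_directed_def by blast
qed

text \<open>A point of a single range is fixed by all later retractions, but continuity cannot be
  used to pass to the closure, since it is derived from this lemma. Instead, decreasing
  neighbourhoods of \<open>y\<close> are built along with increasing indices in \<open>M\<close>. A
  cluster point of points chosen in them is fixed by the retraction at the supremum and yet sent by
  it into the closure of \<open>V\<close>.\<close>

lemma limit_retraction_fixes_closure:
  assumes M: "M \<subseteq> \<Gamma>" "up_directed M le" and y: "y \<in> closure (\<Union>s\<in>M. range (r s))"
  shows "limit_retraction M y = y"
proof (rule ccontr)
  assume "limit_retraction M y \<noteq> y"
  then obtain U V where UV: "open U" "open V" "y \<in> U" "limit_retraction M y \<in> V"
      "closure U \<inter> closure V = {}"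
    using compact_t2_separate_closures[OF compact_UNIV] by metis
  have "eventually (\<lambda>s. r s y \<in> V) (tails M le)"
    using tendsto_limit_retraction[OF M] UV by (auto dest: topological_tendstoD)
  then obtain s0 where s0: "s0 \<in> M" "\<And>t. t \<in> M \<Longrightarrow> (s0, t) \<in> le \<Longrightarrow> r t y \<in> V"
    by (auto simp: eventually_tails[OF M(2) trans_le])
  define P where "P p \<longleftrightarrow> fst p \<in> M \<and> (s0, fst p) \<in> le \<and> open (snd p) \<and> y \<in> snd p \<and> snd p \<subseteq> U" for p
  \<comment> \<open>The new retraction maps the new open set into \<open>V\<close>, while its range
    meets the old open set. This shift by one provides points of \<open>snd (\<pi> n)\<close> that
    are fixed by the retraction number \<open>n + 1\<close>.\<close>
  define Q where "Q p q \<longleftrightarrow> (fst p, fst q) \<in> le \<and> snd q \<subseteq> snd p \<and> snd q \<subseteq> r (fst q) -` V \<and>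
    snd p \<inter> range (r (fst q)) \<noteq> {}" for p q
  have step: "\<exists>q. P q \<and> Q p q" if Pp: "P p" for p
  proof -
    obtain s O1 where p: "p = (s, O1)" by fastforce
    obtain t where t: "t \<in> M" "O1 \<inter> range (r t) \<noteq> {}"
      using y Pp open_Int_closure_eq_empty[of O1 "\<Union>s\<in>M. range (r s)"] by (auto simp: P_def p)
    obtain u where u: "u \<in> M" "(s, u) \<in> le" "(t, u) \<in> le"
      using M(2) t Pp unfolding P_def p up_directed_def by fastforce
    have "open (r u -` V)"
      using continuous_r u M UV by (auto intro: open_vimage)
    moreover have "range (r t) \<subseteq> range (r u)"
      using range_r_mono t u M by blast
    moreover have "(s0, u) \<in> le"
      using le_trans u Pp by (auto simp: P_def p)
    ultimately show ?thesis
      using s0(2)[of u] u t Pp unfolding P_def Q_def p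
      by (intro exI[of _ "(u, O1 \<inter> r u -` V)"]) auto
  qed
  have "P (s0, U)"
    using s0 UV refl_le M by (auto simp: P_def)
  then have "\<exists>\<pi>. \<forall>n. P (\<pi> n) \<and> Q (\<pi> n) (\<pi> (Suc n))"
    by (intro dependent_nat_choice) (use step in auto)
  then obtain \<pi> where \<pi>: "\<And>n. P (\<pi> n)" "\<And>n. Q (\<pi> n) (\<pi> (Suc n))"
    by blast
  define \<sigma> where "\<sigma> n = fst (\<pi> n)" for n
  have inc: "increasing_in \<Gamma> le \<sigma>"
    using \<pi> M by (auto simp: increasing_in_def \<sigma>_def P_def Q_def)
  obtain s where s: "s \<in> \<Gamma>" "\<And>n. (\<sigma> n, s) \<in> le" "\<And>x. (\<lambda>n. r (\<sigma> n) x) \<longlonglongrightarrow> r s x"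
    by (rule increasing_sup[OF inc]) blast
  have "\<exists>w. w \<in> snd (\<pi> n) \<and> w \<in> range (r (\<sigma> (Suc n)))" for n
    using \<pi>(2)[of n] by (auto simp: Q_def \<sigma>_def)
  then obtain w where w: "\<And>n. w n \<in> snd (\<pi> n)" "\<And>n. w n \<in> range (r (\<sigma> (Suc n)))"
    by metis
  obtain v where v: "\<And>C. closed C \<Longrightarrow> eventually (\<lambda>n. w n \<in> C) sequentially \<Longrightarrow> v \<in> C"
    using compact_net_cluster_point[OF compact_UNIV sequentially_bot, where y = w] by blast
  have mono: "snd (\<pi> n) \<subseteq> snd (\<pi> m)" if "m \<le> n" for m n
    using that by (induction rule: dec_induct) (use \<pi>(2) in \<open>auto simp: Q_def\<close>)
  have "v \<in> closure U"
    using w \<pi>(1) closure_subset[of U] unfolding P_def by (intro v always_eventually) blast+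
  have "w n \<in> range (r s)" for n
    using w(2)[of n] range_r_mono[of "\<sigma> (Suc n)" s] inc s by (auto simp: increasing_in_def)
  then have "v \<in> range (r s)"
    using s closed_range_r by (intro v always_eventually) auto
  then have rv: "r s v = v"
    using r_r(1)[of s s] s refl_le by auto
  have "r (\<sigma> (Suc k)) v \<in> closure V" for k
  proof -
    have "closed (r (\<sigma> (Suc k)) -` closure V)"
      using inc continuous_r by (auto simp: increasing_in_def intro: closed_vimage)
    \<comment> \<open>From \<open>Suc k\<close> on, the points lie in the open set chosen at step
      \<open>k + 1\<close>, which \<open>r (\<sigma> (Suc k))\<close> maps into
      \<open>V\<close>.\<close>
    moreover have "w n \<in> r (\<sigma> (Suc k)) -` closure V" if "n \<ge> Suc k" for n
      using mono[OF that] w(1)[of n] \<pi>(2)[of k] closure_subset[of V] by (auto simp: Q_def \<sigma>_def)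
    ultimately have "v \<in> r (\<sigma> (Suc k)) -` closure V"
      by (intro v) (auto simp: eventually_sequentially)
    then show ?thesis
      by simp
  qed
  then have "r s v \<in> closure V"
    by (rule LIMSEQ_in_closed[OF closed_closure _ LIMSEQ_Suc[OF s(3)]])
  with rv \<open>v \<in> closure U\<close> UV show False
    by auto
qed

text \<open>The graph consists of the pairs with \<open>r s x = r s y\<close> for all
  \<open>s\<close> in \<open>M\<close> and \<open>y\<close> in the closure of the ranges: such a
  \<open>y\<close> is fixed, and the limit depends only on the values \<open>r s x\<close>.\<close>

lemma continuous_limit_retraction:
  assumes M: "M \<subseteq> \<Gamma>" "up_directed M le"
  shows "continuous_on UNIV (limit_retraction M)"
proof (rule compact_closed_graph_imp_continuous[OF compact_UNIV])
  fix x y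
  show "y = limit_retraction M x \<longleftrightarrow>
    (\<forall>s\<in>M. r s x = r s y) \<and> y \<in> closure (\<Union>s\<in>M. range (r s))"
    using limit_retraction_eq_iff[OF M, of x y] limit_retraction_in_closure[OF M, of x]
      limit_retraction_fixes_closure[OF M, of y] r_limit_retraction[OF M, of _ x] by auto
qed (use M continuous_r in auto)

end

unbundle cardinal_syntax

section \<open>Hulls under a binary operation and well-orders\<close>

text \<open>Applied to an operation that picks upper bounds, this turns a set of indices into an
  up-directed one without raising an infinite cardinality.\<close>

inductive_set hull_under :: "('b \<Rightarrow> 'b \<Rightarrow> 'b) \<Rightarrow> 'b set \<Rightarrow> 'b set"
  for u :: "'b \<Rightarrow> 'b \<Rightarrow> 'b" and X :: "'b set" where
  generator: "x \<in> X \<Longrightarrow> x \<in> hull_under u X"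
| operation: "x \<in> hull_under u X \<Longrightarrow> y \<in> hull_under u X \<Longrightarrow> u x y \<in> hull_under u X"

lemma hull_under_mono: "x \<in> hull_under u X \<Longrightarrow> X \<subseteq> Y \<Longrightarrow> x \<in> hull_under u Y"
  by (induction rule: hull_under.induct) (auto intro: hull_under.generator hull_under.operation[of _ u])

lemma hull_under_subset:
  assumes "X \<subseteq> M" and "\<And>x y. x \<in> M \<Longrightarrow> y \<in> M \<Longrightarrow> u x y \<in> M"
  shows "hull_under u X \<subseteq> M"
proof
  show "x \<in> M" if "x \<in> hull_under u X" for x
    using that by induction (use assms in auto)
qed

lemma card_hull_under:
  assumes inf: "infinite B" and "|X| \<le>o |B|"
  shows "|hull_under u X| \<le>o |B|"
proof -
  define Y where "Y n = ((\<lambda>Z. Z \<union> (\<lambda>(x, y). u x y) ` (Z \<times> Z)) ^^ n) X" for n :: nat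
  have Y: "Y 0 = X" "Y (Suc n) = Y n \<union> (\<lambda>(x, y). u x y) ` (Y n \<times> Y n)" for n
    by (simp_all add: Y_def)
  have mono: "Y m \<subseteq> Y n" if "m \<le> n" for m n
    using that by (induction rule: dec_induct) (auto simp: Y)
  have "x \<in> (\<Union>n. Y n)" if "x \<in> hull_under u X" for x
    using that
  proof induction
    case (generator x)
    then show ?case
      using Y(1) by blast
  next
    case (operation x y)
    then obtain m n where "x \<in> Y m" "y \<in> Y n"
      by blast
    then have "x \<in> Y (max m n)" "y \<in> Y (max m n)"
      using mono max.cobounded1 max.cobounded2 by blast+
    then have "u x y \<in> Y (Suc (max m n))"
      by (auto simp: Y)
    then show ?case
      by blast
  qed
  then have "hull_under u X \<subseteq> (\<Union>n. Y n)"
    by blast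
  moreover have "|Y n| \<le>o |B|" for n
  proof (induction n)
    case (Suc n)
    have "|Y n \<times> Y n| \<le>o |B|"
      using Suc inf card_of_Card_order[of B]
      by (intro card_of_Times_ordLeq_infinite_Field) (auto simp: Field_card_of)
    then have "|(\<lambda>(x, y). u x y) ` (Y n \<times> Y n)| \<le>o |B|"
      using card_of_image ordLeq_transitive by blast
    then show ?case
      using Suc inf card_of_Card_order[of B] unfolding Y
      by (intro card_of_Un_ordLeq_infinite_Field) (auto simp: Field_card_of)
  qed (use assms in \<open>simp add: Y\<close>)
  then have "|\<Union>n. Y n| \<le>o |B|"
    using inf by (intro card_of_UNION_ordLeq_infinite) (auto simp: infinite_iff_card_of_nat)
  ultimately show ?thesis
    using card_of_mono1 ordLeq_transitive by blast
qed

text \<open>A finite \<open>X\<close> may have an infinite hull, but only a countable one; this is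
  where \<open>M\<close> has to be uncountable.\<close>

lemma card_hull_under_less:
  assumes "uncountable M" and "|X| <o |M|"
  shows "|hull_under u X| <o |M|"
proof (cases "finite X")
  case True
  have "|hull_under u X| \<le>o |UNIV :: nat set|"
    using True by (intro card_hull_under) (auto simp: countable_card_of_nat[symmetric] countable_finite)
  moreover have "|UNIV :: nat set| <o |M|"
    using assms(1) not_ordLeq_iff_ordLess[OF card_of_Well_order card_of_Well_order]
    by (auto simp: countable_card_of_nat)
  ultimately show ?thesis
    by (rule ordLeq_ordLess_trans)
next
  case False
  then show ?thesis
    using assms(2) card_hull_under[OF False] card_of_refl ordIso_imp_ordLeq ordLeq_ordLess_trans by blast
qed

text \<open>The well-order \<open>|M|\<close> is of minimal type, so its proper initial segments
  have smaller cardinality. The extra element \<open>z\<close> leaves room for a generator common to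
  all hulls.\<close>

lemma card_under_less:
  assumes "infinite M" and "m \<in> M"
  shows "|insert z (under |M| m)| <o |M|"
proof -
  have "|underS |M| m| <o |M|"
    using card_of_underS[OF card_of_Card_order[of M]] assms by (simp add: Field_card_of)
  moreover have "|{z, m}| <o |M|"
    using assms by (intro finite_ordLess_infinite card_of_Well_order) (auto simp: Field_card_of)
  ultimately have "|underS |M| m \<union> {z, m}| <o |M|"
    using assms by (intro card_of_Un_ordLess_infinite)
  moreover have "insert z (under |M| m) \<subseteq> underS |M| m \<union> {z, m}"
    by (auto simp: under_def underS_def)
  ultimately show ?thesis
    using card_of_mono1 ordLeq_ordLess_trans by blast
qed

text \<open>The next term is the least element of \<open>W\<close> outside the current initial
  segment. The invariant that this segment meets \<open>W\<close> in a finite set keeps the rest of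
  \<open>W\<close> nonempty.\<close>

lemma infinite_wellorder_sequence:
  assumes R: "Well_order R" and W: "W \<subseteq> Field R" "infinite W"
  obtains \<mu> :: "nat \<Rightarrow> 'b" where "\<And>n. \<mu> n \<in> W" "\<And>n. \<mu> n \<in> underS R (\<mu> (Suc n))"
proof -
  have tot: "(a, b) \<in> R \<or> (b, a) \<in> R" if "a \<in> W" "b \<in> W" for a b
    using R W that unfolding order_on_defs total_on_def refl_on_def by (metis subsetD)
  have least: "\<exists>a\<in>V. \<forall>b\<in>V. (a, b) \<in> R" if V: "V \<subseteq> W" "V \<noteq> {}" for V
  proof -
    have "wf (R - Id)"
      using R by (simp add: well_order_on_def)
    then obtain a where a: "a \<in> V" "\<And>b. (b, a) \<in> R - Id \<Longrightarrow> b \<notin> V"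
      using V(2) by (metis equals0I wfE_min)
    have "(a, b) \<in> R" if "b \<in> V" for b
      using a(2)[of b] tot[of a b] a(1) that V(1) by auto
    then show ?thesis
      using a by blast
  qed
  have "\<exists>\<mu>. \<forall>n. (\<mu> n \<in> W \<and> finite (W \<inter> under R (\<mu> n))) \<and> \<mu> n \<in> underS R (\<mu> (Suc n))"
  proof (rule dependent_nat_choice)
    obtain a where a: "a \<in> W" "\<And>b. b \<in> W \<Longrightarrow> (a, b) \<in> R"
      using least[of W] W by auto
    have "W \<inter> under R a \<subseteq> {a}"
      using a R unfolding order_on_defs antisym_def under_def by blast
    then show "\<exists>a. a \<in> W \<and> finite (W \<inter> under R a)"
      using a finite_subset by blast
  next
    fix m and n :: nat
    assume m: "m \<in> W \<and> finite (W \<inter> under R m)"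
    then have "W - under R m \<noteq> {}"
      using W(2) by (metis Diff_eq_empty_iff Int_absorb2 Int_commute)
    then obtain a where a: "a \<in> W - under R m" "\<And>b. b \<in> W - under R m \<Longrightarrow> (a, b) \<in> R"
      using least[of "W - under R m"] by blast
    have "W \<inter> under R a \<subseteq> insert a (W \<inter> under R m)"
      using a R unfolding order_on_defs antisym_def under_def by blast
    then have "finite (W \<inter> under R a)"
      using m finite_subset by blast
    moreover have "m \<in> underS R a"
      using a(1) m tot[of m a] R W unfolding underS_def under_def order_on_defs refl_on_def by auto
    ultimately show "\<exists>a. (a \<in> W \<and> finite (W \<inter> under R a)) \<and> m \<in> underS R a"
      using a(1) by blast
  qed
  then show thesis
    using that by blast
qed

section \<open>Countable separating families\<close>

text \<open>The functions are truncated distances to the points of a countable dense set, the union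
  of finite 1 / (n + 1)-nets.\<close>

lemma metrizable_compact_separating_sequence:
  assumes "compact S" and "metrizable_space (top_of_set S)" and "S \<noteq> {}"
  obtains g :: "nat \<Rightarrow> 'a::topological_space \<Rightarrow> real"
  where "\<And>n. continuous_on S (g n)" "\<And>n x. \<bar>g n x\<bar> \<le> 1"
    "\<And>x y. x \<in> S \<Longrightarrow> y \<in> S \<Longrightarrow> x \<noteq> y \<Longrightarrow> \<exists>n. g n x \<noteq> g n y"
proof -
  obtain T d where "Metric_space T d" and top: "top_of_set S = Metric_space.mtopology T d"
    using assms(2) by (auto simp: metrizable_space_def)
  then interpret Metric_space T d
    by simp
  have TS: "T = S"
    using arg_cong[OF top, of topspace] by simp
  have "compactin mtopology S"
    using assms(1) by (simp add: top[symmetric] compactin_subtopology)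
  then have "mtotally_bounded S"
    by (rule compactin_imp_mtotally_bounded)
  then have "\<exists>K. finite K \<and> K \<subseteq> S \<and> S \<subseteq> (\<Union>x\<in>K. mball x (1 / Suc n))" for n :: nat
    by (simp add: mtotally_bounded_def)
  then obtain K where K: "\<And>n. finite (K n)" "\<And>n. K n \<subseteq> S"
      "\<And>n::nat. S \<subseteq> (\<Union>x\<in>K n. mball x (1 / Suc n))"
    by metis
  define Q where "Q = (\<Union>n. K n)"
  have "K 0 \<noteq> {}"
    using K(3)[of 0] assms(3) by fastforce
  then have Q: "Q \<noteq> {}" "Q \<subseteq> S"
    unfolding Q_def using K(2) by blast+
  have "countable Q"
    unfolding Q_def by (rule countable_UN[OF countableI_type countable_finite[OF K(1)]])
  define g where "g n x = min 1 (d (from_nat_into Q n) x)" for n x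
  show thesis
  proof (rule that[of g])
    fix n
    have q: "from_nat_into Q n \<in> S"
      by (rule subsetD[OF Q(2) from_nat_into[OF Q(1)]])
    have "continuous_map mtopology euclideanreal (d (from_nat_into Q n))"
      using q continuous_on_mdist[of "from_nat_into Q n" Self]
      unfolding TS[symmetric] by (simp add: Self_def)
    then have "continuous_on S (d (from_nat_into Q n))"
      by (simp flip: top)
    then show "continuous_on S (g n)"
      unfolding g_def by (intro continuous_intros)
    show "\<bar>g n x\<bar> \<le> 1" for x
      by (simp add: g_def)
  next
    fix x y assume xy: "x \<in> S" "y \<in> S" "x \<noteq> y"
    then have "d x y > 0"
      using TS by simp
    \<comment> \<open>With this radius a net point \<open>q\<close> is closer than 1/2 to
      \<open>x\<close>, so that truncation does not change \<open>d q x\<close>, and it is closer to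
      \<open>x\<close> than to \<open>y\<close>.\<close>
    then obtain k :: nat where k: "1 / Suc k < min 1 (d x y) / 2"
      using nat_approx_posE[of "min 1 (d x y) / 2"] by auto
    obtain q where q: "q \<in> K k" "d q x < 1 / Suc k"
      using K(3)[of k] xy by (auto simp: mball_def)
    then obtain n where n: "from_nat_into Q n = q"
      using from_nat_into_surj[OF \<open>countable Q\<close>, of q] by (auto simp: Q_def)
    have "d x y \<le> d q x + d q y"
      using triangle[of x q y] commute[of q x] q K(2) xy TS by auto
    moreover have "d q x < 1 / 2" "d q x < d x y / 2"
      using k q(2) min.cobounded1[of 1 "d x y"] min.cobounded2[of 1 "d x y"] by linarith+
    ultimately have "g n x < g n y"
      unfolding g_def n by linarith
    then show "\<exists>n. g n x \<noteq> g n y"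
      by (metis less_irrefl)
  qed
qed

section \<open>Separating families by transfinite induction\<close>

lemma bdd_above_rho:
  fixes A :: "('a::topological_space \<Rightarrow>\<^sub>C real) set"
  assumes "bounded A"
  shows "bdd_above ((\<lambda>f. \<bar>apply_bcontfun f k - apply_bcontfun f l\<bar>) ` A)"
proof -
  obtain B where B: "\<And>f. f \<in> A \<Longrightarrow> norm f \<le> B"
    using assms by (auto simp: bounded_iff)
  have "\<bar>apply_bcontfun f k - apply_bcontfun f l\<bar> \<le> B + B" if "f \<in> A" for f
    using B[OF that] norm_bounded[of f k] norm_bounded[of f l] by auto
  then show ?thesis
    by (intro bdd_aboveI2)
qed

lemma abs_diff_le_rho:
  assumes "bounded A" and "f \<in> A"
  shows "\<bar>apply_bcontfun f k - apply_bcontfun f l\<bar> \<le> rho A k l"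
  unfolding rho_def by (rule cSUP_upper[OF assms(2) bdd_above_rho[OF assms(1)]])

lemma eventually_rho_less:
  assumes "eps_shrinking A e D \<Gamma> le r" and "x \<in> D" and "increasing_in \<Gamma> le \<sigma>"
    and "is_supremum \<Gamma> le (range \<sigma>) s" and "e < d"
  shows "eventually (\<lambda>n. rho A (r (\<sigma> n) x) (r s x) < d) sequentially"
proof -
  have "limsup (\<lambda>n. ereal (rho A (r (\<sigma> n) x) (r s x))) \<le> ereal e"
    using assms by (auto simp: eps_shrinking_def)
  also have "\<dots> < ereal d"
    using assms by simp
  finally have "eventually (\<lambda>n. ereal (rho A (r (\<sigma> n) x) (r s x)) < ereal d) sequentially"
    by (rule Limsup_lessD)
  then show ?thesis
    by simp
qed

text \<open>Soft thresholding: for \<open>c > 0\<close>, this is \<open>t\<close> minus its nearest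
  point in the interval from \<open>- c\<close> to \<open>c\<close>. It is continuous, vanishes on
  that interval and loses no information outside it.\<close>

definition threshold :: "real \<Rightarrow> real \<Rightarrow> real" where
  "threshold c t = t - max (- c) (min c t)"

lemma threshold:
  assumes "c > 0"
  shows "\<bar>threshold c t\<bar> \<le> \<bar>t\<bar>" and "threshold c t \<noteq> 0 \<Longrightarrow> c < \<bar>t\<bar>"
    and "threshold c s = threshold c t \<Longrightarrow> c < \<bar>s\<bar> \<Longrightarrow> s = t"
  using assms by (auto simp: threshold_def max_def min_def abs_if split: if_splits)

lemma continuous_on_threshold: "continuous_on UNIV f \<Longrightarrow> continuous_on UNIV (\<lambda>x. threshold c (f x))"
  unfolding threshold_def by (intro continuous_intros)

context skeleton
begin

section \<open>Base of the induction: countable sets of indices\<close>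

definition c0_separating :: "'a set \<Rightarrow> 'g set \<Rightarrow> ('a \<Rightarrow> real) set \<Rightarrow> bool" where
  "c0_separating D M F \<longleftrightarrow>
     (\<forall>f\<in>F. continuous_on UNIV f \<and> (\<forall>x. \<bar>f x\<bar> \<le> 1)) \<and>
     (\<forall>x\<in>D. \<forall>e>0. finite {f \<in> F. \<bar>f x\<bar> > e}) \<and>
     (\<forall>x y. (\<exists>t\<in>M. r t x \<noteq> r t y) \<longrightarrow> (\<exists>f\<in>F. f x \<noteq> f y))"

text \<open>A countable directed \<open>M\<close> is dominated by an increasing sequence, hence by
  its supremum \<open>s\<close>, and \<open>r s\<close> has metrizable range. Countably many
  functions on that range suffice, and the denominators \<open>2 ^ n\<close> put them in c_0 at
  every point.\<close>

lemma c0_separating_countable: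
  assumes M: "M \<subseteq> \<Gamma>" "up_directed M le" "countable M"
  shows "\<exists>F. c0_separating D M F"
proof -
  have "M \<noteq> {}"
    using M(2) by (simp add: up_directed_def)
  have "\<exists>\<sigma>. \<forall>n. (\<sigma> n \<in> M \<and> (from_nat_into M n, \<sigma> n) \<in> le) \<and> (\<sigma> n, \<sigma> (Suc n)) \<in> le"
  proof (rule dependent_nat_choice)
    show "\<exists>s. s \<in> M \<and> (from_nat_into M 0, s) \<in> le"
      using from_nat_into[OF \<open>M \<noteq> {}\<close>, of 0] M(1) refl_le by blast
    fix s n assume "s \<in> M \<and> (from_nat_into M n, s) \<in> le"
    then show "\<exists>t. (t \<in> M \<and> (from_nat_into M (Suc n), t) \<in> le) \<and> (s, t) \<in> le"
      using from_nat_into[OF \<open>M \<noteq> {}\<close>, of "Suc n"] M(2) unfolding up_directed_def by blast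
  qed
  then obtain \<sigma> where \<sigma>: "\<And>n. \<sigma> n \<in> M" "\<And>n. (from_nat_into M n, \<sigma> n) \<in> le" "\<And>n. (\<sigma> n, \<sigma> (Suc n)) \<in> le"
    by blast
  have "increasing_in \<Gamma> le \<sigma>"
    using \<sigma> M by (auto simp: increasing_in_def)
  then obtain s where s: "s \<in> \<Gamma>" "\<And>n. (\<sigma> n, s) \<in> le"
    by (rule increasing_sup) blast
  have upper: "(t, s) \<in> le" if t: "t \<in> M" for t
  proof -
    obtain n where "from_nat_into M n = t"
      using from_nat_into_surj[OF M(3) t] by blast
    then show ?thesis
      using \<sigma>(2)[of n] s(2)[of n] le_trans by blast
  qed
  have "compact (range (r s))"
    using compact_UNIV closed_range_r[OF s(1)] by (metis compact_Int_closed inf_top_left)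
  then obtain g :: "nat \<Rightarrow> 'a \<Rightarrow> real" where g: "\<And>n. continuous_on (range (r s)) (g n)" "\<And>n x. \<bar>g n x\<bar> \<le> 1"
    "\<And>x y. x \<in> range (r s) \<Longrightarrow> y \<in> range (r s) \<Longrightarrow> x \<noteq> y \<Longrightarrow> \<exists>n. g n x \<noteq> g n y"
    by (rule metrizable_compact_separating_sequence[OF _ metrizable_range_r[OF s(1)]]) auto
  define G where "G n x = g n (r s x) / 2 ^ n" for n x
  have bound: "\<bar>G n x\<bar> \<le> (1/2) ^ n" for n x
    using g(2)[of n "r s x"] by (simp add: G_def abs_divide power_divide divide_right_mono)
  have "continuous_on UNIV (G n)" for n
    unfolding G_def using continuous_on_compose2[OF g(1) continuous_r[OF s(1)]]
    by (intro continuous_intros) auto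
  moreover have "\<bar>G n x\<bar> \<le> 1" for n x
    using bound[of n x] power_le_one[of "1/2::real" n] by linarith
  moreover have "finite {f \<in> range G. \<bar>f x\<bar> > e}" if "e > 0" for x e
  proof -
    obtain N where N: "(1/2::real) ^ N < e"
      using real_arch_pow_inv[OF \<open>e > 0\<close>, of "1/2"] by auto
    have "n < N" if "\<bar>G n x\<bar> > e" for n
    proof (rule ccontr)
      assume "\<not> n < N"
      then have "(1/2::real) ^ n \<le> (1/2) ^ N"
        by (intro power_decreasing) auto
      then show False
        using bound[of n x] N that by linarith
    qed
    then have "{f \<in> range G. \<bar>f x\<bar> > e} \<subseteq> G ` {..<N}"
      by auto
    then show ?thesis
      by (rule finite_subset) simp
  qed
  moreover have "\<exists>f\<in>range G. f x \<noteq> f y" if "t \<in> M" "r t x \<noteq> r t y" for t x y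
  proof -
    have "r t (r s z) = r t z" for z
      using r_r(2)[of t s] upper that M(1) s(1) by blast
    then have "r s x \<noteq> r s y"
      using that(2) by metis
    then obtain n where "g n (r s x) \<noteq> g n (r s y)"
      using g(3)[of "r s x" "r s y"] by blast
    then have "G n x \<noteq> G n y"
      by (simp add: G_def)
    then show ?thesis
      by blast
  qed
  ultimately have "c0_separating D M (range G)"
    unfolding c0_separating_def by blast
  then show ?thesis
    by blast
qed

section \<open>Jumps between consecutive directed sets\<close>

lemma ex_jump:
  assumes L: "L \<subseteq> \<Gamma>" "up_directed L le" and H: "H \<subseteq> \<Gamma>" "up_directed H le" "L \<subseteq> H"
    and c: "c \<in> L" and f: "continuous_on UNIV (f :: 'a \<Rightarrow> real)"
    and jump: "\<bar>f (limit_retraction H x) - f (limit_retraction L x)\<bar> > d"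
  shows "\<exists>p. (fst p \<in> L \<and> snd p \<in> H \<and> (fst p, snd p) \<in> le \<and> \<bar>f (r (snd p) x) - f (r (fst p) x)\<bar> > d)
    \<and> (c, fst p) \<in> le"
proof -
  \<comment> \<open>Half of the excess over \<open>d\<close>: replacing both limits by values at
    indices costs less than \<open>2 * e\<close>.\<close>
  define e where "e = (\<bar>f (limit_retraction H x) - f (limit_retraction L x)\<bar> - d) / 2"
  have "e > 0"
    using jump by (simp add: e_def)
  have near: "\<exists>t\<in>N. (s, t) \<in> le \<and> \<bar>f (r t x) - f (limit_retraction N x)\<bar> < e"
    if N: "N \<subseteq> \<Gamma>" "up_directed N le" and s: "s \<in> N" for N s
  proof -
    have "isCont f (limit_retraction N x)"
      using f by (simp add: continuous_on_eq_continuous_at)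
    then have "((\<lambda>t. f (r t x)) \<longlongrightarrow> f (limit_retraction N x)) (tails N le)"
      using tendsto_limit_retraction[OF N] by (rule isCont_tendsto_compose)
    then have "eventually (\<lambda>t. dist (f (r t x)) (f (limit_retraction N x)) < e) (tails N le)"
      using \<open>e > 0\<close> by (rule tendstoD)
    then obtain t0 where t0: "t0 \<in> N"
      "\<And>t. t \<in> N \<Longrightarrow> (t0, t) \<in> le \<Longrightarrow> dist (f (r t x)) (f (limit_retraction N x)) < e"
      by (auto simp: eventually_tails[OF N(2) trans_le])
    obtain t where "t \<in> N" "(s, t) \<in> le" "(t0, t) \<in> le"
      using N(2) s t0(1) unfolding up_directed_def by blast
    then show ?thesis
      using t0(2)[of t] by (auto simp: dist_real_def)
  qed
  obtain a where a: "a \<in> L" "(c, a) \<in> le" "\<bar>f (r a x) - f (limit_retraction L x)\<bar> < e"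
    using near[OF L c] by blast
  obtain b where b: "b \<in> H" "(a, b) \<in> le" "\<bar>f (r b x) - f (limit_retraction H x)\<bar> < e"
    using near[OF H(1,2)] a(1) H(3) by blast
  have "\<bar>f (r b x) - f (r a x)\<bar> > d"
    using a(3) b(3) by (auto simp: e_def field_simps abs_if split: if_splits)
  then show ?thesis
    using a b by (intro exI[of _ "(a, b)"]) simp
qed

text \<open>Indices \<open>a k\<close> in \<open>L k\<close> and \<open>b k\<close> in
  \<open>H k\<close> that realise the jumps interleave, so both sequences have the same supremum
  \<open>s\<close>. Shrinking eventually brings both within \<open>d / 2\<close> of
  \<open>r s x\<close> with respect to \<open>rho A\<close>. As this is uniform over
  \<open>A\<close>, the functions \<open>f k\<close> may vary with \<open>k\<close>.\<close>

lemma no_infinitely_many_jumps: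
  assumes A: "bounded A" "eps_shrinking A e D \<Gamma> le r" and x: "x \<in> D" and "2 * e < d"
    and L: "\<And>k::nat. L k \<subseteq> \<Gamma>" "\<And>k. up_directed (L k) le" "\<And>k. L k \<subseteq> H k"
    and H: "\<And>k. H k \<subseteq> \<Gamma>" "\<And>k. up_directed (H k) le" "\<And>k. H k \<subseteq> L (Suc k)"
    and f: "\<And>k. f k \<in> A"
    and jump: "\<And>k. \<bar>apply_bcontfun (f k) (limit_retraction (H k) x) -
                  apply_bcontfun (f k) (limit_retraction (L k) x)\<bar> > d"
  shows False
proof -
  define P where "P k p \<longleftrightarrow> fst p \<in> L k \<and> snd p \<in> H k \<and> (fst p, snd p) \<in> le \<and>
    \<bar>apply_bcontfun (f k) (r (snd p) x) - apply_bcontfun (f k) (r (fst p) x)\<bar> > d" for k p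
  have step: "\<exists>p. P k p \<and> (c, fst p) \<in> le" if "c \<in> L k" for k c
    unfolding P_def using continuous_on_apply_bcontfun that
    by (intro ex_jump[OF L(1,2) H(1,2) L(3) _ _ jump]) auto
  have "\<exists>\<pi>. \<forall>k. P k (\<pi> k) \<and> (snd (\<pi> k), fst (\<pi> (Suc k))) \<in> le"
  proof (rule dependent_nat_choice)
    obtain c where "c \<in> L 0"
      using L(2)[of 0] by (auto simp: up_directed_def)
    then show "\<exists>p. P 0 p"
      using step by blast
  next
    fix p k assume "P k p"
    then have "snd p \<in> L (Suc k)"
      using H(3) by (auto simp: P_def)
    then show "\<exists>q. P (Suc k) q \<and> (snd p, fst q) \<in> le"
      by (rule step)
  qed
  then obtain \<pi> where \<pi>: "\<And>k. P k (\<pi> k)" "\<And>k. (snd (\<pi> k), fst (\<pi> (Suc k))) \<in> le"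
    by blast
  define a b where "a k = fst (\<pi> k)" and "b k = snd (\<pi> k)" for k
  have ab: "a k \<in> \<Gamma>" "b k \<in> \<Gamma>" "(a k, b k) \<in> le" "(b k, a (Suc k)) \<in> le"
    "\<bar>apply_bcontfun (f k) (r (b k) x) - apply_bcontfun (f k) (r (a k) x)\<bar> > d" for k
    using \<pi>[of k] L(1)[of k] H(1)[of k] by (auto simp: P_def a_def b_def)
  have inc: "increasing_in \<Gamma> le a" "increasing_in \<Gamma> le b"
    using ab le_trans unfolding increasing_in_def by blast+
  obtain s where s: "is_supremum \<Gamma> le (range a) s"
    by (rule increasing_sup[OF inc(1)]) blast
  have "is_supremum \<Gamma> le (range b) s"
    unfolding is_supremum_def
  proof (intro conjI ballI impI)
    show "s \<in> \<Gamma>"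
      using s by (simp add: is_supremum_def)
    show "(t, s) \<in> le" if t: "t \<in> range b" for t
    proof -
      obtain k where k: "t = b k"
        using t by blast
      have "(a (Suc k), s) \<in> le"
        using s by (auto simp: is_supremum_def)
      then show ?thesis
        unfolding k using ab(4)[of k] le_trans by blast
    qed
    show "(s, u) \<in> le" if u: "u \<in> \<Gamma>" "\<forall>t\<in>range b. (t, u) \<in> le" for u
    proof -
      have "(a k, u) \<in> le" for k
        using ab(3)[of k] u(2) le_trans[of "a k" "b k" u] by blast
      then show ?thesis
        using s u(1) by (auto simp: is_supremum_def)
    qed
  qed
  then have "eventually (\<lambda>k. rho A (r (b k) x) (r s x) < d / 2) sequentially"
    using inc A x assms(4) by (intro eventually_rho_less[OF A(2) x inc(2)]) auto
  moreover have "eventually (\<lambda>k. rho A (r (a k) x) (r s x) < d / 2) sequentially"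
    using inc s A x assms(4) by (intro eventually_rho_less[OF A(2) x inc(1) s]) auto
  ultimately have "eventually (\<lambda>k. False) sequentially"
  proof eventually_elim
    case (elim k)
    have "\<bar>apply_bcontfun (f k) (r (b k) x) - apply_bcontfun (f k) (r s x)\<bar> < d / 2"
      "\<bar>apply_bcontfun (f k) (r (a k) x) - apply_bcontfun (f k) (r s x)\<bar> < d / 2"
      using elim abs_diff_le_rho[OF A(1) f[of k]] le_less_trans by blast+
    then show False
      using ab(5)[of k] by linarith
  qed
  then show False
    by simp
qed

end

lemma ex_bcontfun_of_bounded:
  assumes "continuous_on UNIV f" and "\<And>x. \<bar>f x\<bar> \<le> 1"
  obtains g :: "'a::topological_space \<Rightarrow>\<^sub>C real" where "apply_bcontfun g = f" "g \<in> cball 0 1"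
proof
  have "f \<in> bcontfun"
    using assms by (auto simp: bcontfun_def bounded_iff)
  then show eq: "apply_bcontfun (Bcontfun f) = f"
    by (rule Bcontfun_inverse)
  have "norm (Bcontfun f) \<le> 1"
    by (rule norm_bound) (simp add: eq assms)
  then show "Bcontfun f \<in> cball 0 1"
    by simp
qed

context skeleton
begin

section \<open>Inductive step: uncountable sets of indices\<close>

lemma limit_retraction_in:
  assumes "closed_under_limits D \<Gamma> le r" and "x \<in> D" and M: "M \<subseteq> \<Gamma>" "up_directed M le"
  shows "limit_retraction M x \<in> D"
  using assms limit_retraction_eqI[OF M] unfolding closed_under_limits_def by metis

text \<open>Finiteness at a point of \<open>D\<close> is counted in layers: the weights leave
  finitely many pairs \<open>(n, p)\<close>, the exclusion of infinitely many jumps leaves finitely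
  many \<open>m\<close>, and the c_0 property of \<open>F m\<close> at two points of
  \<open>D\<close> leaves finitely many \<open>g\<close>.\<close>

lemma c0_separating_uncountable:
  assumes lim: "closed_under_limits D \<Gamma> le r"
    and A: "\<And>p::nat. bounded (A p)" "\<And>p. eps_shrinking (A p) (E p) D \<Gamma> le r"
    and cover: "\<And>g e. g \<in> cball 0 1 \<Longrightarrow> 0 < e \<Longrightarrow> \<exists>p. g \<in> A p \<and> E p < e"
    and M: "M \<subseteq> \<Gamma>" "up_directed M le" "uncountable M"
    and IH: "\<And>N. N \<subseteq> \<Gamma> \<Longrightarrow> up_directed N le \<Longrightarrow> |N| <o |M| \<Longrightarrow> \<exists>F. c0_separating D N F"
  shows "\<exists>F. c0_separating D M F"
proof -
  have R: "Well_order |M|" "Field |M| = M"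
    using card_of_Well_order by (auto simp: Field_card_of)
  have R_refl: "(m, m) \<in> |M|" if "m \<in> M" for m
    using R that unfolding order_on_defs refl_on_def by metis
  have R_trans: "(m, m') \<in> |M| \<Longrightarrow> (m', m'') \<in> |M| \<Longrightarrow> (m, m'') \<in> |M|" for m m' m''
    using R(1) unfolding order_on_defs by (metis transD)
  have R_total: "(m, m') \<in> |M| \<or> (m', m) \<in> |M|" if "m \<in> M" "m' \<in> M" for m m'
    using R R_refl that unfolding order_on_defs total_on_def by metis
  have R_wf: "wf ( |M| - Id)"
    using R(1) by (simp add: well_order_on_def)
  obtain m0 where m0: "m0 \<in> M"
    using M(2) by (auto simp: up_directed_def)
  obtain u where u: "\<And>s t. s \<in> M \<Longrightarrow> t \<in> M \<Longrightarrow> u s t \<in> M \<and> (s, u s t) \<in> le \<and> (t, u s t) \<in> le"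
    using M(2) unfolding up_directed_def by metis
  \<comment> \<open>The generator \<open>m0\<close> makes even the hull of the empty set nonempty,
    hence up-directed.\<close>
  define C where "C X = hull_under u (insert m0 X)" for X
  have C_subset: "C X \<subseteq> M" if "X \<subseteq> M" for X
    unfolding C_def using that m0 u by (intro hull_under_subset) auto
  have C_op: "u s t \<in> C X" if "s \<in> C X" "t \<in> C X" for s t X
    using that unfolding C_def by (rule hull_under.operation)
  have C_gen: "insert m0 X \<subseteq> C X" for X
    unfolding C_def by (auto intro: hull_under.generator)
  have C_mono: "C X \<subseteq> C Y" if "X \<subseteq> Y" for X Y
    unfolding C_def using hull_under_mono[of _ u "insert m0 X" "insert m0 Y"] that by blast
  have C_directed: "up_directed (C X) le" if X: "X \<subseteq> M" for X
    unfolding up_directed_def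
  proof (intro conjI ballI)
    show "C X \<noteq> {}"
      using C_gen by blast
    fix s t assume "s \<in> C X" "t \<in> C X"
    then show "\<exists>v\<in>C X. (s, v) \<in> le \<and> (t, v) \<in> le"
      using C_op[of s X t] C_subset[OF X] u[of s t] by blast
  qed
  \<comment> \<open>The generators of \<open>hi m\<close> are those of \<open>lo m\<close> together
    with \<open>m\<close>: these are consecutive members of a chain along the cardinal well-order of
    \<open>M\<close>.\<close>
  define lo hi where "lo m = C (underS |M| m)" and "hi m = C (under |M| m)" for m
  have under_subset: "under |M| m \<subseteq> M" "underS |M| m \<subseteq> under |M| m" for m
    using R(2) by (auto simp: under_def underS_def Field_def)
  have hi: "hi m \<subseteq> M" "up_directed (hi m) le" for m
    unfolding hi_def using C_subset C_directed under_subset by blast+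
  have lo: "lo m \<subseteq> M" "up_directed (lo m) le" "lo m \<subseteq> hi m" for m
    unfolding lo_def hi_def using C_subset C_directed C_mono under_subset by (meson subset_trans)+
  have hi_mono: "hi m \<subseteq> hi m'" if "(m, m') \<in> |M|" for m m'
    unfolding hi_def using that R_trans by (intro C_mono) (auto simp: under_def)
  have hi_self: "m \<in> hi m" if "m \<in> M" for m
    using C_gen[of "under |M| m"] R_refl[OF that] by (auto simp: hi_def under_def)
  have hi_lo: "hi m \<subseteq> lo m'" if "m \<in> underS |M| m'" for m m'
    unfolding hi_def lo_def
  proof (rule C_mono)
    show "under |M| m \<subseteq> underS |M| m'"
      using that R_trans R(1) unfolding under_def underS_def order_on_defs antisym_def by blast
  qed
  \<comment> \<open>Continuity of the chain: an element of the hull arises from finitely many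
    generators, all of which lie in the \<open>hi\<close> of the largest of them. If nothing
    precedes \<open>m\<close>, only \<open>C {}\<close> is left, which therefore gets its own family
    \<open>F0\<close>.\<close>
  have lo_cases: "t \<in> C {} \<or> (\<exists>m'\<in>underS |M| m. t \<in> hi m')" if "t \<in> lo m" for t m
    using that unfolding lo_def C_def[of "underS |M| m"]
  proof induction
    case (generator t)
    then show ?case
    proof (cases "t = m0")
      case False
      then have "t \<in> underS |M| m"
        using generator by blast
      moreover have "t \<in> hi t"
        using \<open>t \<in> underS |M| m\<close> under_subset by (intro hi_self) blast
      ultimately show ?thesis
        by blast
    qed (use C_gen in blast)
  next
    case (operation s t)
    have hi0: "C {} \<subseteq> hi m'" for m'
      unfolding hi_def by (rule C_mono) simp
    have op: "u s t \<in> hi m'" if "s \<in> hi m'" "t \<in> hi m'" for m'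
      using that C_op by (simp add: hi_def)
    have "\<exists>m'\<in>underS |M| m. s \<in> hi m' \<and> t \<in> hi m'" if "m1 \<in> underS |M| m" "s \<in> hi m1" "m2 \<in> underS |M| m" "t \<in> hi m2" for m1 m2
      using R_total[of m1 m2] hi_mono[of m1 m2] hi_mono[of m2 m1] that under_subset by blast
    then show ?case
      using operation(3,4) op hi0 C_op[of s "{}" t] by (meson subsetD)
  qed
  have C_less: "|C X| <o |M|" if "|insert m0 X| <o |M|" for X
    unfolding C_def using M(3) that by (rule card_hull_under_less)
  have infM: "infinite M"
    using M(3) countable_finite by blast
  have "\<exists>F. c0_separating D (hi m) F" if "m \<in> M" for m
    using hi[of m] M(1) unfolding hi_def
    by (intro IH C_less card_under_less[OF infM that]) auto
  then obtain F where F: "\<And>m. m \<in> M \<Longrightarrow> c0_separating D (hi m) (F m)"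
    by metis
  have "|insert m0 {}| <o |M|"
    using infM by (intro finite_ordLess_infinite card_of_Well_order) (auto simp: Field_card_of)
  then obtain F0 where F0: "c0_separating D (C {}) F0"
    using IH[OF _ _ C_less] C_subset[of "{}"] C_directed[of "{}"] M(1) by blast
  define J where "J m g x = apply_bcontfun g (limit_retraction (hi m) x) - apply_bcontfun g (limit_retraction (lo m) x)"
    for m and g :: "'a \<Rightarrow>\<^sub>C real" and x
  \<comment> \<open>The condition on \<open>E p\<close> is the one under which infinitely many jumps
    above 1 / (n + 1) are impossible. The same \<open>g\<close> may occur with many \<open>n\<close>
    and \<open>p\<close>.\<close>
  define I where "I = {(n, p, m, g). m \<in> M \<and> g \<in> A p \<and> apply_bcontfun g \<in> F m \<and> 2 * E p < 1 / Suc n}"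
  \<comment> \<open>The additional 1 in the exponent compensates for the bound 2 on
    \<open>J\<close>.\<close>
  define \<Phi> where "\<Phi> = (\<lambda>(n, p, m, g) x. threshold (1 / Suc n) (J m g x) / 2 ^ (n + p + 1))"
  have hi\<Gamma>: "hi m \<subseteq> \<Gamma>" and lo\<Gamma>: "lo m \<subseteq> \<Gamma>" for m
    using hi(1) lo(1) M(1) by blast+
  note hi' = hi\<Gamma> hi(2) and lo' = lo\<Gamma> lo(2)
  have J_cont: "continuous_on UNIV (J m g)" for m g
    unfolding J_def using continuous_limit_retraction[OF hi'] continuous_limit_retraction[OF lo']
    by (intro continuous_intros continuous_on_compose2[OF continuous_on_apply_bcontfun[of UNIV g]]) auto
  have J_bound: "\<bar>J m g x\<bar> \<le> 2" if "m \<in> M" "apply_bcontfun g \<in> F m" for m g x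
  proof -
    have "\<bar>apply_bcontfun g z\<bar> \<le> 1" for z
      using F[OF that(1)] that(2) unfolding c0_separating_def by blast
    from this[of "limit_retraction (hi m) x"] this[of "limit_retraction (lo m) x"] show ?thesis
      unfolding J_def by linarith
  qed
  have \<Phi>_bound: "\<bar>\<Phi> (n, p, m, g) x\<bar> \<le> (1/2) ^ n" "\<bar>\<Phi> (n, p, m, g) x\<bar> \<le> (1/2) ^ p"
    if "(n, p, m, g) \<in> I" for n p m g x
  proof -
    have "\<bar>threshold (1 / Suc n) (J m g x)\<bar> \<le> 2"
      using threshold(1)[of "1 / Suc n" "J m g x"] J_bound[of m g x] that by (auto simp: I_def)
    then have "\<bar>\<Phi> (n, p, m, g) x\<bar> \<le> 2 / 2 ^ (n + p + 1)"
      unfolding \<Phi>_def by (simp add: abs_divide divide_right_mono del: power_Suc)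
    also have "\<dots> = (1/2) ^ n * (1/2) ^ p"
      by (simp add: power_add power_divide)
    finally have "\<bar>\<Phi> (n, p, m, g) x\<bar> \<le> (1/2) ^ n * (1/2) ^ p" .
    moreover have "(1/2::real) ^ n * (1/2) ^ p \<le> (1/2) ^ n" "(1/2::real) ^ n * (1/2) ^ p \<le> (1/2) ^ p"
      by (simp_all add: mult_left_le mult_left_le_one_le power_le_one)
    ultimately show "\<bar>\<Phi> (n, p, m, g) x\<bar> \<le> (1/2) ^ n" "\<bar>\<Phi> (n, p, m, g) x\<bar> \<le> (1/2) ^ p"
      by linarith+
  qed
  have jumps: "finite {m \<in> M. \<exists>g\<in>A p. \<bar>J m g x\<bar> > d}" if x: "x \<in> D" and d: "2 * E p < d" for x p d
  proof (rule ccontr)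
    let ?W = "{m \<in> M. \<exists>g\<in>A p. \<bar>J m g x\<bar> > d}"
    assume "infinite ?W"
    then obtain \<mu> :: "nat \<Rightarrow> 'g" where \<mu>: "\<And>n. \<mu> n \<in> ?W" "\<And>n. \<mu> n \<in> underS |M| (\<mu> (Suc n))"
      using R by (rule_tac infinite_wellorder_sequence[of "|M|" ?W]) auto
    from \<mu>(1) have "\<forall>n. \<exists>g. g \<in> A p \<and> \<bar>J (\<mu> n) g x\<bar> > d"
      by blast
    from choice[OF this] obtain g where g: "\<And>n. g n \<in> A p" "\<And>n. \<bar>J (\<mu> n) (g n) x\<bar> > d"
      by blast
    show False
      using no_infinitely_many_jumps[OF A x d, where L = "\<lambda>n. lo (\<mu> n)" and H = "\<lambda>n. hi (\<mu> n)" and f = g]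
        hi' lo' lo(3) hi_lo[OF \<mu>(2)] g by (simp add: J_def)
  qed
  have \<Phi>_cont: "continuous_on UNIV (\<Phi> i)" for i
    unfolding \<Phi>_def case_prod_beta
    by (intro continuous_intros continuous_on_threshold J_cont) simp
  have \<Phi>_le: "\<bar>\<Phi> i x\<bar> \<le> 1" if "i \<in> I" for i x
  proof -
    obtain n p m g where "i = (n, p, m, g)"
      using prod_cases4 by blast
    then show ?thesis
      using \<Phi>_bound(1)[of n p m g x] power_le_one[of "1/2::real" n] that by simp
  qed
  have "c0_separating D M (F0 \<union> \<Phi> ` I)"
    unfolding c0_separating_def
  proof (intro conjI ballI allI impI)
    fix f assume f: "f \<in> F0 \<union> \<Phi> ` I"
    then show "continuous_on UNIV f"
      using F0 \<Phi>_cont unfolding c0_separating_def by blast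
    show "\<bar>f x\<bar> \<le> 1" for x
      using f F0 \<Phi>_le unfolding c0_separating_def by blast
  next
    fix x and e :: real assume x: "x \<in> D" and e: "0 < e"
    obtain N where N: "(1/2::real) ^ N < e"
      using real_arch_pow_inv[OF e, of "1/2"] by auto
    have less_N: "n < N" if "(1/2::real) ^ n > e" for n
    proof (rule ccontr)
      assume "\<not> n < N"
      then have "(1/2::real) ^ n \<le> (1/2) ^ N"
        by (intro power_decreasing) auto
      with N that show False
        by linarith
    qed
    define W where "W n p = (if 2 * E p < 1 / Suc n then {m \<in> M. \<exists>g\<in>A p. \<bar>J m g x\<bar> > 1 / Suc n} else {})" for n p
    \<comment> \<open>A jump larger than \<open>e\<close> forces \<open>g\<close> to exceed
      \<open>e / 2\<close> in absolute value at one of its two arguments, and both arguments lie in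
      \<open>D\<close>.\<close>
    define V where "V m = {g. apply_bcontfun g \<in> {f \<in> F m. \<bar>f (limit_retraction (hi m) x)\<bar> > e / 2} \<union>
      {f \<in> F m. \<bar>f (limit_retraction (lo m) x)\<bar> > e / 2}}" for m
    have finV: "finite (V m)" if "m \<in> M" for m
      unfolding V_def
    proof (rule finite_vimageI[unfolded vimage_def])
      show "inj (apply_bcontfun :: ('a \<Rightarrow>\<^sub>C real) \<Rightarrow> _)"
        by (simp add: inj_def bcontfun_eqI)
      have "limit_retraction (hi m) x \<in> D" "limit_retraction (lo m) x \<in> D"
        by (intro limit_retraction_in[OF lim x] hi' lo')+
      then show "finite ({f \<in> F m. \<bar>f (limit_retraction (hi m) x)\<bar> > e / 2} \<union>
          {f \<in> F m. \<bar>f (limit_retraction (lo m) x)\<bar> > e / 2})"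
        using F[OF that] half_gt_zero[OF e] unfolding c0_separating_def by blast
    qed
    have finW: "finite (W n p)" "W n p \<subseteq> M" for n p
      using jumps[OF x] by (auto simp: W_def)
    define T where "T = (SIGMA n:{..<N}. SIGMA p:{..<N}. SIGMA m:W n p. V m)"
    have "finite T"
      unfolding T_def by (intro finite_SigmaI finite_lessThan finW(1) finV subsetD[OF finW(2)])
    have "i \<in> T" if i: "i \<in> I" "\<bar>\<Phi> i x\<bar> > e" for i
    proof -
      obtain n p m g where ieq: "i = (n, p, m, g)"
        using prod_cases4 by blast
      have I': "m \<in> M" "g \<in> A p" "apply_bcontfun g \<in> F m" "2 * E p < 1 / Suc n"
        using i(1) by (auto simp: ieq I_def)
      have "n < N" "p < N"
        using \<Phi>_bound[of n p m g x] i by (auto simp: ieq intro!: less_N)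
      have thr: "\<bar>threshold (1 / Suc n) (J m g x)\<bar> > e"
      proof -
        have "\<bar>\<Phi> i x\<bar> = \<bar>threshold (1 / Suc n) (J m g x)\<bar> / 2 ^ (n + p + 1)"
          by (simp add: \<Phi>_def ieq abs_divide)
        also have "\<dots> \<le> \<bar>threshold (1 / Suc n) (J m g x)\<bar> / 1"
          by (intro divide_left_mono) (auto simp del: power_Suc)
        finally show ?thesis
          using i(2) by simp
      qed
      then have "\<bar>J m g x\<bar> > 1 / Suc n" "\<bar>J m g x\<bar> > e"
        using threshold(1,2)[of "1 / Suc n" "J m g x"] e by auto
      then have "m \<in> W n p" "g \<in> V m"
        using I' by (auto simp: W_def V_def J_def)
      then show ?thesis
        using \<open>n < N\<close> \<open>p < N\<close> by (auto simp: T_def ieq)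
    qed
    then have "{f \<in> F0 \<union> \<Phi> ` I. \<bar>f x\<bar> > e} \<subseteq> {f \<in> F0. \<bar>f x\<bar> > e} \<union> \<Phi> ` T"
      by blast
    moreover have "finite {f \<in> F0. \<bar>f x\<bar> > e}"
      using F0 x e by (simp add: c0_separating_def)
    ultimately show "finite {f \<in> F0 \<union> \<Phi> ` I. \<bar>f x\<bar> > e}"
      using \<open>finite T\<close> by (meson finite_UnI finite_imageI finite_subset)
  next
    fix x y assume xy: "\<exists>t\<in>M. r t x \<noteq> r t y"
    show "\<exists>f\<in>F0 \<union> \<Phi> ` I. f x \<noteq> f y"
    proof (cases "\<exists>t\<in>C {}. r t x \<noteq> r t y")
      case True
      then show ?thesis
        using F0 unfolding c0_separating_def by blast
    next
      case False
      let ?B = "{m \<in> M. \<exists>t\<in>hi m. r t x \<noteq> r t y}"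
      obtain t where t: "t \<in> M" "r t x \<noteq> r t y"
        using xy by blast
      then have "t \<in> ?B"
        using hi_self by blast
      \<comment> \<open>This is the first stage that tells \<open>x\<close> and \<open>y\<close>
        apart. Neither an earlier stage nor \<open>C {}\<close> does, so the limit retraction of
        \<open>lo m\<close> sends both points to the same place and only the \<open>hi m\<close>
        part of the jump can differ.\<close>
      then obtain m where m: "m \<in> ?B" "\<And>m'. (m', m) \<in> |M| - Id \<Longrightarrow> m' \<notin> ?B"
        by (rule wfE_min[OF R_wf]) blast
      have "r t x = r t y" if "t \<in> lo m" for t
        using lo_cases[OF that] False m(2) under_subset by (fastforce simp: underS_def under_def)
      then have eq_lo: "limit_retraction (lo m) x = limit_retraction (lo m) y"
        by (simp add: limit_retraction_eq_iff[OF lo'])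
      obtain t' where t': "t' \<in> hi m" "r t' x \<noteq> r t' y"
        using m(1) by blast
      then have "\<exists>t\<in>hi m. r t (limit_retraction (hi m) x) \<noteq> r t (limit_retraction (hi m) y)"
        by (metis r_limit_retraction[OF hi'])
      then obtain f where f: "f \<in> F m" "f (limit_retraction (hi m) x) \<noteq> f (limit_retraction (hi m) y)"
        using F[of m] m(1) unfolding c0_separating_def by blast
      have "continuous_on UNIV f" "\<bar>f z\<bar> \<le> 1" for z
        using F[of m] m(1) f(1) unfolding c0_separating_def by blast+
      then obtain g :: "'a \<Rightarrow>\<^sub>C real" where g: "apply_bcontfun g = f" "g \<in> cball 0 1"
        by (rule ex_bcontfun_of_bounded)
      have Jne: "J m g x \<noteq> J m g y"
        using f(2) eq_lo by (simp add: J_def g(1))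
      then have "max \<bar>J m g x\<bar> \<bar>J m g y\<bar> > 0"
        by auto
      \<comment> \<open>A level below the larger of the two jumps keeps their difference visible
        after thresholding.\<close>
      then obtain n :: nat where n: "1 / Suc n < max \<bar>J m g x\<bar> \<bar>J m g y\<bar>"
        using nat_approx_posE by blast
      then have thr: "threshold (1 / Suc n) (J m g x) \<noteq> threshold (1 / Suc n) (J m g y)"
        using Jne threshold(3)[of "1 / Suc n" "J m g x" "J m g y"] threshold(3)[of "1 / Suc n" "J m g y" "J m g x"]
        by (auto simp: less_max_iff_disj)
      obtain p where p: "g \<in> A p" "E p < 1 / Suc n / 2"
        using cover[OF g(2), of "1 / Suc n / 2"] by auto
      have "2 * E p < 1 / Suc n"
        using p(2) by (simp only: less_divide_eq_numeral1 mult.commute)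
      then have "(n, p, m, g) \<in> I"
        using m(1) p(1) f(1) g(1) by (simp add: I_def)
      moreover have "\<Phi> (n, p, m, g) x \<noteq> \<Phi> (n, p, m, g) y"
        using thr by (simp add: \<Phi>_def)
      ultimately show ?thesis
        by blast
    qed
  qed
  then show ?thesis
    by blast
qed

lemma ex_c0_separating:
  assumes "closed_under_limits D \<Gamma> le r"
    and "\<And>p::nat. bounded (A p)" "\<And>p. eps_shrinking (A p) (E p) D \<Gamma> le r"
    and "\<And>g e. g \<in> cball 0 1 \<Longrightarrow> 0 < e \<Longrightarrow> \<exists>p. g \<in> A p \<and> E p < e"
  shows "\<exists>F. c0_separating D \<Gamma> F"
proof -
  have "M \<subseteq> \<Gamma> \<longrightarrow> up_directed M le \<longrightarrow> (\<exists>F. c0_separating D M F)" for M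
  proof (induction M rule: wf_induct_rule[OF wf_inv_image[OF wf_ordLess, of card_of]])
    case (1 M)
    show ?case
    proof (intro impI, cases "countable M")
      assume M: "M \<subseteq> \<Gamma>" "up_directed M le"
      case True
      with M show "\<exists>F. c0_separating D M F"
        by (rule c0_separating_countable)
    next
      assume M: "M \<subseteq> \<Gamma>" "up_directed M le"
      case False
      show "\<exists>F. c0_separating D M F"
        using 1 by (intro c0_separating_uncountable[OF assms M False]) (auto simp: inv_image_def)
    qed
  qed
  then show ?thesis
    using up_directed_carrier by blast
qed

end

section \<open>Families of coordinate functions\<close>

lemma evaluation_embedding_map:
  fixes S :: "'a::topological_space set"
  assumes "compact S" and cont: "\<And>i. i \<in> I \<Longrightarrow> continuous_on S (e i)"
    and sep: "\<And>x y. x \<in> S \<Longrightarrow> y \<in> S \<Longrightarrow> x \<noteq> y \<Longrightarrow> \<exists>i\<in>I. e i x \<noteq> e i y"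
  shows "embedding_map (top_of_set S) (powertop_real I) (\<lambda>x. \<lambda>i\<in>I. e i x)"
proof (rule injective_closed_imp_embedding_map)
  show c: "continuous_map (top_of_set S) (powertop_real I) (\<lambda>x. \<lambda>i\<in>I. e i x)"
    using cont by (auto simp: continuous_map_componentwise)
  show "closed_map (top_of_set S) (powertop_real I) (\<lambda>x. \<lambda>i\<in>I. e i x)"
    using assms(1) by (intro T1_Spaces.continuous_imp_closed_map[OF c])
      (auto simp: Hausdorff_space_product_topology compact_space_subtopology)
  show "inj_on (\<lambda>x. \<lambda>i\<in>I. e i x) (topspace (top_of_set S))"
  proof (rule inj_onI, rule ccontr)
    fix x y assume xy: "x \<in> topspace (top_of_set S)" "y \<in> topspace (top_of_set S)" "x \<noteq> y"
      and eq: "(\<lambda>i\<in>I. e i x) = (\<lambda>i\<in>I. e i y)"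
    then obtain i where "i \<in> I" "e i x \<noteq> e i y"
      using sep by auto
    then show False
      using fun_cong[OF eq, of i] by simp
  qed
qed

lemma metrizable_of_countable_separating:
  assumes "compact S" and "countable I" and "\<And>i. i \<in> I \<Longrightarrow> continuous_on S (e i :: _ \<Rightarrow> real)"
    and "\<And>x y. x \<in> S \<Longrightarrow> y \<in> S \<Longrightarrow> x \<noteq> y \<Longrightarrow> \<exists>i\<in>I. e i x \<noteq> e i y"
  shows "metrizable_space (top_of_set S)"
proof -
  have "metrizable_space (powertop_real I)"
    using assms(2) by (auto simp: metrizable_space_product_topology metrizable_space_euclidean)
  then show ?thesis
    using homeomorphic_metrizable_space[OF embedding_map_imp_homeomorphic_space[OF evaluation_embedding_map[OF assms(1,3,4)]]]
    by (simp add: metrizable_space_subtopology)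
qed

definition c0_points :: "('a \<Rightarrow> real) set \<Rightarrow> 'a set" where
  "c0_points F = {x. \<forall>e>0. finite {f \<in> F. \<bar>f x\<bar> > e}}"

text \<open>Semi-Eberlein compactness in terms of the set of coordinate functions. The bound 2
  accommodates \<open>arctan\<close> as well as families bounded by 1.\<close>

definition dense_c0_family :: "('a::topological_space \<Rightarrow> real) set \<Rightarrow> bool" where
  "dense_c0_family F \<longleftrightarrow> (\<forall>f\<in>F. continuous_on UNIV f \<and> (\<forall>x. \<bar>f x\<bar> \<le> 2)) \<and>
     (\<forall>x y. x \<noteq> y \<longrightarrow> (\<exists>f\<in>F. f x \<noteq> f y)) \<and> closure (c0_points F) = UNIV"

lemma semi_EberleinI:
  assumes "compact (UNIV :: 'a::t2_space set)" and F: "dense_c0_family (F :: ('a \<Rightarrow> real) set)"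
  shows "semi_Eberlein TYPE(('a, 'i) coord_index) TYPE('a)"
proof -
  define I :: "('a, 'i) coord_index set" where "I = Inl ` F"
  define h where "h x = (\<lambda>i\<in>I. projl i x)" for x
  have "embedding_map euclidean (powertop_real I) h"
    using evaluation_embedding_map[of UNIV I projl] assms
    by (force simp: h_def[abs_def] I_def dense_c0_family_def)
  moreover have "c0_points F \<subseteq> h -` c0 I"
  proof
    fix x assume x: "x \<in> c0_points F"
    have "finite {i \<in> I. \<bar>h x i\<bar> > e}" if "e > 0" for e
    proof -
      have "{i \<in> I. \<bar>h x i\<bar> > e} = Inl ` {f \<in> F. \<bar>f x\<bar> > e}"
        by (auto simp: h_def I_def)
      then show ?thesis
        using x that by (simp add: c0_points_def)
    qed
    then show "x \<in> h -` c0 I"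
      by (simp add: c0_def h_def)
  qed
  then have "closure (h -` c0 I) = UNIV"
    using F closure_mono[of "c0_points F" "h -` c0 I"] by (auto simp: dense_c0_family_def)
  ultimately show ?thesis
    unfolding semi_Eberlein_def by blast
qed

text \<open>Composing the coordinates with \<open>arctan\<close> bounds them uniformly without affecting separation
  or membership in \<open>c\<^sub>0\<close>.\<close>

lemma semi_EberleinE:
  assumes "semi_Eberlein TYPE('i) TYPE('a::t2_space)"
  obtains F :: "('a::t2_space \<Rightarrow> real) set" where "dense_c0_family F"
proof -
  obtain I and h :: "'a \<Rightarrow> 'i \<Rightarrow> real" where emb: "embedding_map euclidean (powertop_real I) h"
    and dense: "closure (h -` c0 I) = UNIV"
    using assms by (auto simp: semi_Eberlein_def)
  have homeo: "homeomorphic_map euclidean (subtopology (powertop_real I) (range h)) h"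
    using emb by (simp add: embedding_map_def)
  then have hc: "continuous_map euclidean (powertop_real I) h"
    using homeomorphic_imp_continuous_map continuous_map_into_fulltopology by blast
  have inj: "inj h"
    using homeomorphic_imp_injective_map[OF homeo] by simp
  have ext: "h x \<in> extensional I" for x
    using hc by (auto simp: continuous_map_componentwise)
  define g where "g i x = arctan (h x i)" for i x
  have "continuous_on UNIV (g i)" if "i \<in> I" for i
    using hc that unfolding g_def by (intro continuous_intros) (auto simp: continuous_map_componentwise)
  moreover have "\<bar>g i x\<bar> \<le> 2" for i x
    using arctan_bounded[of "h x i"] pi_less_4 unfolding g_def by linarith
  moreover have "\<exists>f\<in>g ` I. f x \<noteq> f y" if "x \<noteq> y" for x y
  proof -
    have "h x \<noteq> h y"
      using inj that by (auto dest: injD)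
    then obtain i where "h x i \<noteq> h y i"
      by blast
    then show ?thesis
      using ext[of x] ext[of y] by (cases "i \<in> I") (auto simp: g_def extensional_def arctan_eq_iff)
  qed
  moreover have "h -` c0 I \<subseteq> c0_points (g ` I)"
  proof
    fix x assume x: "x \<in> h -` c0 I"
    have "finite {f \<in> g ` I. \<bar>f x\<bar> > e}" if "e > 0" for e
    proof -
      have "\<bar>g i x\<bar> \<le> \<bar>h x i\<bar>" for i
        unfolding g_def by (rule abs_arctan_le)
      then have "{f \<in> g ` I. \<bar>f x\<bar> > e} \<subseteq> g ` {i \<in> I. \<bar>h x i\<bar> > e}"
        by (auto intro: less_le_trans)
      moreover have "finite {i \<in> I. \<bar>h x i\<bar> > e}"
        using x that by (simp add: c0_def)
      ultimately show ?thesis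
        by (meson finite_imageI finite_subset)
    qed
    then show "x \<in> c0_points (g ` I)"
      by (simp add: c0_points_def)
  qed
  then have "closure (c0_points (g ` I)) = UNIV"
    using dense closure_mono[of "h -` c0 I" "c0_points (g ` I)"] by auto
  ultimately have "dense_c0_family (g ` I)"
    unfolding dense_c0_family_def by blast
  then show thesis
    by (rule that)
qed

section \<open>Countable covers of the unit ball\<close>

lemma rho_Lipschitz_dense:
  fixes A :: "('a::t2_space \<Rightarrow>\<^sub>C real) set"
  assumes K: "compact (UNIV :: 'a set)" and A: "bounded A" "A \<noteq> {}" "separates_points A"
    and f: "continuous_on UNIV f" and "e > 0"
  obtains g and m :: nat where "\<And>k l. \<bar>g k - g l\<bar> \<le> m * rho A k l" "\<And>x. \<bar>f x - g x\<bar> < e"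
proof -
  obtain a where "a \<in> A"
    using A(2) by blast
  have rho_nonneg: "rho A k l \<ge> 0" for k l
    using abs_diff_le_rho[OF A(1) \<open>a \<in> A\<close>, of k l] by linarith
  \<comment> \<open>The pseudometric \<open>rho A\<close> need not be continuous, so a Lipschitz
    estimate does not imply continuity and the class demands both.\<close>
  define P where "P g \<longleftrightarrow> continuous_on UNIV g \<and> (\<exists>m\<ge>0. \<forall>k l. \<bar>g k - g l\<bar> \<le> m * rho A k l)"
    for g :: "'a \<Rightarrow> real"
  have "\<exists>g. P g \<and> (\<forall>x\<in>UNIV. \<bar>f x - g x\<bar> < e)"
  proof (rule Stone_Weierstrass_HOL[OF K])
    show "P (\<lambda>x. c)" for c
      by (auto simp: P_def)
    show "continuous_on UNIV g" if "P g" for g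
      using that by (simp add: P_def)
    show "P (\<lambda>x. g x + h x)" if "P g \<and> P h" for g h
    proof -
      obtain m n where "0 \<le> m" "0 \<le> n" "\<And>k l. \<bar>g k - g l\<bar> \<le> m * rho A k l" "\<And>k l. \<bar>h k - h l\<bar> \<le> n * rho A k l"
        using \<open>P g \<and> P h\<close> unfolding P_def by blast
      then have "\<bar>(g k + h k) - (g l + h l)\<bar> \<le> (m + n) * rho A k l" "0 \<le> m + n" for k l
        unfolding distrib_right by (smt (verit))+
      then show ?thesis
        using \<open>P g \<and> P h\<close> unfolding P_def by (blast intro: continuous_on_add)
    qed
    show "P (\<lambda>x. g x * h x)" if "P g \<and> P h" for g h
    proof -
      obtain m n where mn: "0 \<le> m" "0 \<le> n" "\<And>k l. \<bar>g k - g l\<bar> \<le> m * rho A k l" "\<And>k l. \<bar>h k - h l\<bar> \<le> n * rho A k l"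
        using \<open>P g \<and> P h\<close> unfolding P_def by blast
      have "bounded (range g)" "bounded (range h)"
        using \<open>P g \<and> P h\<close> K unfolding P_def by (auto intro!: compact_imp_bounded compact_continuous_image)
      then obtain B C where B: "\<And>x. \<bar>g x\<bar> \<le> B" and C: "\<And>x. \<bar>h x\<bar> \<le> C"
        by (auto simp: bounded_iff)
      have BC: "0 \<le> B" "0 \<le> C"
        using B C abs_ge_zero order_trans by blast+
      have "\<bar>g k * h k - g l * h l\<bar> \<le> (B * n + C * m) * rho A k l" for k l
      proof -
        have "\<bar>g k * h k - g l * h l\<bar> = \<bar>g k * (h k - h l) + h l * (g k - g l)\<bar>"
          by (simp add: algebra_simps)
        also have "\<dots> \<le> \<bar>g k\<bar> * \<bar>h k - h l\<bar> + \<bar>h l\<bar> * \<bar>g k - g l\<bar>"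
          by (metis abs_mult abs_triangle_ineq)
        also have "\<dots> \<le> B * (n * rho A k l) + C * (m * rho A k l)"
          using B C mn BC by (intro add_mono mult_mono) auto
        finally show ?thesis
          by (simp add: algebra_simps)
      qed
      moreover have "0 \<le> B * n + C * m"
        using BC mn by simp
      ultimately show ?thesis
        using \<open>P g \<and> P h\<close> unfolding P_def by (blast intro: continuous_on_mult)
    qed
    show "\<exists>g. P g \<and> g x \<noteq> g y" if xy: "x \<in> UNIV \<and> y \<in> UNIV \<and> x \<noteq> y" for x y
    proof -
      obtain g where g: "g \<in> A" "apply_bcontfun g x \<noteq> apply_bcontfun g y"
        using A(3) xy unfolding separates_points_def by blast
      have "\<bar>apply_bcontfun g k - apply_bcontfun g l\<bar> \<le> 1 * rho A k l" for k l
        using abs_diff_le_rho[OF A(1) g(1)] by simp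
      then have "P (apply_bcontfun g)"
        unfolding P_def using continuous_on_apply_bcontfun zero_le_one by blast
      then show ?thesis
        using g(2) by blast
    qed
  qed fact+
  then obtain g m where gm: "\<And>k l. \<bar>g k - g l\<bar> \<le> m * rho A k l" "\<And>x. \<bar>f x - g x\<bar> < e"
    unfolding P_def by blast
  \<comment> \<open>Natural numbers as Lipschitz constants keep the number of classes
    countable.\<close>
  obtain M :: nat where "m \<le> M"
    using real_arch_simple by blast
  then have "\<bar>g k - g l\<bar> \<le> M * rho A k l" for k l
    using gm(1)[of k l] mult_right_mono[OF \<open>m \<le> M\<close> rho_nonneg[of k l]] by linarith
  then show thesis
    using gm(2) that by blast
qed

lemma eps_shrinking_of_le:
  fixes A B :: "('a::topological_space \<Rightarrow>\<^sub>C real) set"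
  assumes "shrinking A D \<Gamma> le r" and "\<And>k l. rho B k l \<le> e + c * rho A k l"
  shows "eps_shrinking B e D \<Gamma> le r"
  unfolding eps_shrinking_def
proof (intro ballI allI impI)
  fix x \<sigma> s assume "x \<in> D" "increasing_in \<Gamma> le \<sigma>" "is_supremum \<Gamma> le (range \<sigma>) s"
  then have "(\<lambda>n. rho A (r (\<sigma> n) x) (r s x)) \<longlonglongrightarrow> 0"
    using assms(1) by (simp add: shrinking_def)
  then have "(\<lambda>n. e + c * rho A (r (\<sigma> n) x) (r s x)) \<longlonglongrightarrow> e + c * 0"
    by (intro tendsto_intros)
  then have "limsup (\<lambda>n. ereal (e + c * rho A (r (\<sigma> n) x) (r s x))) = ereal e"
    by (intro lim_imp_Limsup) auto
  moreover have "limsup (\<lambda>n. ereal (rho B (r (\<sigma> n) x) (r s x))) \<le> limsup (\<lambda>n. ereal (e + c * rho A (r (\<sigma> n) x) (r s x)))"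
    using assms(2) by (intro Limsup_mono always_eventually) simp
  ultimately show "limsup (\<lambda>n. ereal (rho B (r (\<sigma> n) x) (r s x))) \<le> ereal e"
    by simp
qed

text \<open>Since \<open>\<epsilon>\<close> is a function of the set, the sets belonging to different precisions must differ.
  The constants \<open>1 / (k + 1)\<close> serve as markers: a set of precision \<open>2 / (n + 1)\<close> contains exactly
  those with \<open>k \<le> n\<close>.\<close>

lemma shrinking_imp_countable_eps_shrinking:
  fixes A :: "('a::t2_space \<Rightarrow>\<^sub>C real) set"
  assumes K: "compact (UNIV :: 'a set)" and A: "bounded A" "A \<noteq> {}" "separates_points A"
    and shr: "shrinking A D \<Gamma> le r"
  shows "\<exists>(\<A> :: ('a \<Rightarrow>\<^sub>C real) set set) \<epsilon>. countable \<A> \<and> (\<forall>B\<in>\<A>. B \<noteq> {} \<and> B \<subseteq> cball 0 1) \<and>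
    (\<forall>B\<in>\<A>. \<epsilon> B > 0 \<and> eps_shrinking B (\<epsilon> B) D \<Gamma> le r) \<and>
    (\<forall>e>0. cball 0 1 = \<Union>{B \<in> \<A>. \<epsilon> B < e})"
proof -
  obtain a where "a \<in> A"
    using A(2) by blast
  have rho_nonneg: "rho A k l \<ge> 0" for k l
    using abs_diff_le_rho[OF A(1) \<open>a \<in> A\<close>, of k l] by linarith
  \<comment> \<open>Two errors below 1 / (n + 1) turn the Lipschitz estimate for \<open>h\<close>
    into the bound 2 / (n + 1) + m * \<open>rho A\<close> for \<open>g\<close>; hence the numerator
    2 in \<open>\<epsilon>\<close>.\<close>
  define B where "B m n = {g \<in> cball 0 1. \<exists>h. (\<forall>k l. \<bar>h k - h l\<bar> \<le> real m * rho A k l) \<and>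
    (\<forall>x. \<bar>apply_bcontfun g x - h x\<bar> < 1 / Suc n)}" for m n :: nat
  define c :: "nat \<Rightarrow> 'a \<Rightarrow>\<^sub>C real" where "c k = const_bcontfun (1 / Suc k)" for k
  define S where "S m n = (B m n - range c) \<union> c ` {..n}" for m n
  have c_apply: "apply_bcontfun (c k) x = 1 / Suc k" for k x
    by (simp add: c_def const_bcontfun.rep_eq)
  have "inj c"
  proof (rule injI)
    fix j k assume "c j = c k"
    then have "1 / real (Suc j) = 1 / real (Suc k)"
      by (metis c_apply)
    then show "j = k"
      by simp
  qed
  have S_marks: "{k. c k \<in> S m n} = {..n}" for m n
    using \<open>inj c\<close> by (auto simp: S_def inj_image_mem_iff dest: injD)
  define \<epsilon> where "\<epsilon> X = 2 / Suc (Max {k. c k \<in> X})" for X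
  have \<epsilon>: "\<epsilon> (S m n) = 2 / Suc n" for m n
  proof -
    have "Max {..n} = n"
      by (rule Max_eqI) auto
    then show ?thesis
      by (simp add: \<epsilon>_def S_marks)
  qed
  have c_ball: "c k \<in> cball 0 1" for k
    using norm_bound[of "c k" 1] by (simp add: c_apply)
  have S_ball: "S m n \<subseteq> cball 0 1" for m n
    using c_ball by (auto simp: S_def B_def)
  have "rho (S m n) k l \<le> 2 / Suc n + m * rho A k l" for m n k l
    unfolding rho_def[of "S m n"]
  proof (rule cSUP_least)
    show "S m n \<noteq> {}"
      by (auto simp: S_def)
    fix g assume "g \<in> S m n"
    then consider "g \<in> B m n" | j where "g = c j"
      by (auto simp: S_def)
    then show "\<bar>apply_bcontfun g k - apply_bcontfun g l\<bar> \<le> 2 / Suc n + m * rho A k l"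
    proof cases
      case 1
      then obtain h where h: "\<bar>h k - h l\<bar> \<le> m * rho A k l"
        "\<bar>apply_bcontfun g k - h k\<bar> < 1 / Suc n" "\<bar>apply_bcontfun g l - h l\<bar> < 1 / Suc n"
        by (auto simp: B_def)
      have "2 / real (Suc n) = 1 / Suc n + 1 / Suc n"
        by simp
      with h show ?thesis
        by linarith
    next
      case 2
      then show ?thesis
        using rho_nonneg by (simp add: c_apply)
    qed
  qed
  then have shr_S: "eps_shrinking (S m n) (2 / Suc n) D \<Gamma> le r" for m n
    by (rule eps_shrinking_of_le[OF shr])
  have cover: "\<exists>m n. g \<in> S m n \<and> 2 / Suc n < e" if g: "g \<in> cball 0 1" and "e > 0" for g e
  proof -
    obtain n :: nat where n: "1 / Suc n < e / 2"
      using nat_approx_posE[of "e / 2"] \<open>e > 0\<close> by auto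
    have small: "2 / real (Suc k) < e" if "k \<ge> n" for k
    proof -
      have "1 / real (Suc k) \<le> 1 / Suc n"
        using that by (intro divide_left_mono) auto
      then show ?thesis
        using n by simp
    qed
    show ?thesis
    proof (cases "g \<in> range c")
      case True
      then obtain k where "g = c k"
        by blast
      \<comment> \<open>A marker belongs only to the sets whose \<open>n\<close> is at least its own
        number, so the precision has to be taken at least that fine.\<close>
      then have "g \<in> S 0 (max k n)"
        by (auto simp: S_def)
      then show ?thesis
        using small[of "max k n"] by auto
    next
      case False
      have "continuous_on UNIV (apply_bcontfun g)"
        by simp
      moreover have "0 < 1 / real (Suc n)"
        by simp
      ultimately obtain h and m :: nat where "\<And>k l. \<bar>h k - h l\<bar> \<le> m * rho A k l"
          "\<And>x. \<bar>apply_bcontfun g x - h x\<bar> < 1 / Suc n"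
        by (rule rho_Lipschitz_dense[OF K A]) (rule that)
      then have "g \<in> S m n"
        using g False unfolding S_def B_def by blast
      then show ?thesis
        using small[of n] by blast
    qed
  qed
  define \<A> where "\<A> = range (\<lambda>(m, n). S m n)"
  have "countable \<A>"
    by (simp add: \<A>_def)
  moreover have "\<forall>B\<in>\<A>. B \<noteq> {} \<and> B \<subseteq> cball 0 1"
    using S_ball by (force simp: \<A>_def S_def)
  moreover have "\<forall>B\<in>\<A>. \<epsilon> B > 0 \<and> eps_shrinking B (\<epsilon> B) D \<Gamma> le r"
    using shr_S by (auto simp: \<A>_def \<epsilon>)
  moreover have "cball 0 1 = \<Union>{B \<in> \<A>. \<epsilon> B < e}" if "e > 0" for e
  proof
    show "cball 0 1 \<subseteq> \<Union>{B \<in> \<A>. \<epsilon> B < e}"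
    proof
      fix g :: "'a \<Rightarrow>\<^sub>C real" assume "g \<in> cball 0 1"
      then obtain m n where "g \<in> S m n" "2 / Suc n < e"
        using cover \<open>e > 0\<close> by blast
      then have "g \<in> S m n" "S m n \<in> \<A>" "\<epsilon> (S m n) < e"
        by (auto simp: \<A>_def \<epsilon>)
      then show "g \<in> \<Union>{B \<in> \<A>. \<epsilon> B < e}"
        by blast
    qed
    show "\<Union>{B \<in> \<A>. \<epsilon> B < e} \<subseteq> cball 0 1"
      using S_ball unfolding \<A>_def by blast
  qed
  ultimately show ?thesis
    by blast
qed

section \<open>The skeleton of a family of coordinates\<close>

locale c0_family =
  fixes F :: "('a::t2_space \<Rightarrow> real) set"
  assumes compact_UNIV: "compact (UNIV :: 'a set)"
    and dense_c0_family: "dense_c0_family F"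
begin

lemma continuous: "f \<in> F \<Longrightarrow> continuous_on UNIV f"
  and bounded: "f \<in> F \<Longrightarrow> \<bar>f x\<bar> \<le> 2"
  and dense: "closure (c0_points F) = UNIV"
  using dense_c0_family by (auto simp: dense_c0_family_def)

lemma separating: "x \<noteq> y \<Longrightarrow> \<exists>f\<in>F. f x \<noteq> f y"
  using dense_c0_family unfolding dense_c0_family_def by blast

lemma eqI: "(\<And>f. f \<in> F \<Longrightarrow> f x = f y) \<Longrightarrow> x = y"
  using separating by blast

lemma tendsto_coordinates:
  assumes "\<And>f. f \<in> F \<Longrightarrow> ((\<lambda>s. f (y s)) \<longlongrightarrow> f l) G"
  shows "(y \<longlongrightarrow> l) G"
proof (cases "G = bot")
  case False
  obtain l' where l': "(y \<longlongrightarrow> l') G" "\<And>f. f \<in> F \<Longrightarrow> f l' = f l"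
    using tendsto_of_separating_family[where F = F and c = "\<lambda>f. f l" and y = y and G = G,
        OF compact_UNIV False continuous separating assms] by blast
  then show ?thesis
    using eqI[of l' l] by simp
qed simp

text \<open>In coordinates: the image of the space is stable under replacing all coordinates outside
  \<open>A\<close> by 0. An arbitrary countable \<open>A\<close> may fail this.\<close>

definition good :: "('a \<Rightarrow> real) set \<Rightarrow> bool" where
  "good A \<longleftrightarrow> A \<subseteq> F \<and> countable A \<and> (\<forall>x. \<exists>y. \<forall>f\<in>F. f y = (if f \<in> A then f x else 0))"

definition proj :: "('a \<Rightarrow> real) set \<Rightarrow> 'a \<Rightarrow> 'a" where
  "proj A x = (SOME y. \<forall>f\<in>F. f y = (if f \<in> A then f x else 0))"

lemma proj: "good A \<Longrightarrow> f \<in> F \<Longrightarrow> f (proj A x) = (if f \<in> A then f x else 0)"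
  using someI_ex[of "\<lambda>y. \<forall>f\<in>F. f y = (if f \<in> A then f x else 0)"]
  unfolding good_def proj_def by blast

text \<open>The set \<open>U\<close> may be uncountable and is not assumed to be good: the limit
  point itself shows that truncation to \<open>U\<close> stays in the space. This serves both for
  suprema of increasing sequences and for limits along arbitrary directed sets.\<close>

lemma proj_limit:
  assumes "G \<noteq> bot" and good: "\<And>s. s \<in> M \<Longrightarrow> good (a s)" and M: "eventually (\<lambda>s. s \<in> M) G"
    and "\<And>f. f \<in> U \<Longrightarrow> f \<in> F \<Longrightarrow> eventually (\<lambda>s. f \<in> a s) G" and "\<And>s. s \<in> M \<Longrightarrow> a s \<subseteq> U"
  obtains l where "((\<lambda>s. proj (a s) x) \<longlongrightarrow> l) G" "\<And>f. f \<in> F \<Longrightarrow> f l = (if f \<in> U then f x else 0)"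
proof (rule tendsto_of_separating_family[where F = F and c = "\<lambda>f. if f \<in> U then f x else 0",
      OF compact_UNIV assms(1) continuous separating])
  fix f assume f: "f \<in> F"
  have "eventually (\<lambda>s. (f \<in> a s) = (f \<in> U)) G"
  proof (cases "f \<in> U")
    case True
    then show ?thesis
      using assms(4) f by simp
  next
    case False
    show ?thesis
      using M by eventually_elim (use False assms(5) in blast)
  qed
  with M have "eventually (\<lambda>s. f (proj (a s) x) = (if f \<in> U then f x else 0)) G"
    by eventually_elim (simp add: proj[OF good f])
  then show "((\<lambda>s. f (proj (a s) x)) \<longlongrightarrow> (if f \<in> U then f x else 0)) G"
    by (rule tendsto_eventually)
qed (use that in blast)+

lemma continuous_proj:
  assumes "good A"
  shows "continuous_on UNIV (proj A)"
  unfolding continuous_on_def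
proof
  fix x
  show "(proj A \<longlongrightarrow> proj A x) (at x within UNIV)"
  proof (rule tendsto_coordinates)
    fix f assume f: "f \<in> F"
    have "(f \<longlongrightarrow> f x) (at x)"
      using continuous[OF f] by (simp add: continuous_on_def)
    then show "((\<lambda>z. f (proj A z)) \<longlongrightarrow> f (proj A x)) (at x within UNIV)"
      by (simp add: proj[OF assms f])
  qed
qed

lemma proj_proj:
  assumes "good A" "good B" "A \<subseteq> B"
  shows "proj B (proj A x) = proj A x" "proj A (proj B x) = proj A x"
  using assms by (auto intro!: eqI simp: proj)

lemma good_subset: "good A \<Longrightarrow> A \<subseteq> F"
  by (simp add: good_def)

lemma compact_range_proj: "good A \<Longrightarrow> compact (range (proj A))"
  using compact_continuous_image[OF continuous_proj compact_UNIV] .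

lemma metrizable_range_proj:
  assumes A: "good A"
  shows "metrizable_space (top_of_set (range (proj A)))"
proof (rule metrizable_of_countable_separating[where I = A and e = "\<lambda>f. f"])
  show "countable A"
    using A by (simp add: good_def)
  show "continuous_on (range (proj A)) f" if "f \<in> A" for f
    using continuous_on_subset[OF continuous] good_subset[OF A] that by blast
  fix x y assume "x \<in> range (proj A)" "y \<in> range (proj A)" "x \<noteq> y"
  then obtain x' y' f where "x = proj A x'" "y = proj A y'" "f \<in> F" "f x \<noteq> f y"
    using separating by blast
  then show "\<exists>f\<in>A. f x \<noteq> f y"
    using proj[OF A, of f] by (intro bexI[of _ f]) (auto split: if_splits)
qed (rule compact_range_proj[OF A])

definition support :: "'a \<Rightarrow> ('a \<Rightarrow> real) set" where
  "support x = {f \<in> F. f x \<noteq> 0}"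

lemma countable_support:
  assumes "x \<in> c0_points F"
  shows "countable (support x)"
proof -
  have "support x \<subseteq> (\<Union>n. {f \<in> F. \<bar>f x\<bar> > 1 / Suc n})"
  proof
    fix f assume "f \<in> support x"
    then have "f \<in> F" "\<bar>f x\<bar> > 0"
      by (auto simp: support_def)
    then show "f \<in> (\<Union>n. {f \<in> F. \<bar>f x\<bar> > 1 / Suc n})"
      using nat_approx_posE[of "\<bar>f x\<bar>"] by auto
  qed
  moreover have "countable {f \<in> F. \<bar>f x\<bar> > 1 / Suc n}" for n
    using assms unfolding c0_points_def by (intro countable_finite) simp
  ultimately show ?thesis
    by (meson countable_UN countableI_type countable_subset)
qed

text \<open>Density of \<open>C\<close> in the coarsest topology that makes the functions in
  \<open>A\<close> continuous.\<close>

definition dense_in_coordinates :: "('a \<Rightarrow> real) set \<Rightarrow> 'a set \<Rightarrow> bool" where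
  "dense_in_coordinates A C \<longleftrightarrow>
     (\<forall>x S. \<forall>e>0. finite S \<longrightarrow> S \<subseteq> A \<longrightarrow> (\<exists>c\<in>C. \<forall>f\<in>S. \<bar>f c - f x\<bar> < e))"

text \<open>There are countably many boxes with finitely many coordinates in \<open>A\<close>,
  rational centres and radius 1 / (n + 1). One c_0 point is picked from each box that contains
  any.\<close>

lemma ex_countable_dense_in_coordinates:
  assumes A: "A \<subseteq> F" "countable A"
  shows "\<exists>C \<subseteq> c0_points F. countable C \<and> dense_in_coordinates A C"
proof -
  define ok where "ok p c \<longleftrightarrow> c \<in> c0_points F \<and> (\<forall>(f, q)\<in>set (fst p). \<bar>f c - q\<bar> < 1 / Suc (snd p))"
    for p :: "(('a \<Rightarrow> real) \<times> real) list \<times> nat" and c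
  define P where "P = {p \<in> lists (A \<times> \<rat>) \<times> UNIV. \<exists>c. ok p c}"
  define pick where "pick p = (SOME c. ok p c)" for p
  have pick: "ok p (pick p)" if "p \<in> P" for p
    using that someI_ex[of "ok p"] by (auto simp: P_def pick_def)
  have "countable P"
    unfolding P_def using A(2) countable_rat
    by (intro countable_Collect countable_SIGMA countable_lists) auto
  moreover have "\<exists>p\<in>P. \<forall>f\<in>S. \<bar>f (pick p) - f x\<bar> < e" if e: "e > 0" and S: "finite S" "S \<subseteq> A" for x S e
  proof -
    obtain n :: nat where n: "1 / Suc n < e / 2"
      using nat_approx_posE[of "e / 2"] e by auto
    \<comment> \<open>The picked point will be within \<open>d\<close> of a rational centre and the
      centre within \<open>d / 2\<close> of \<open>x\<close>, so \<open>d < e / 2\<close> is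
      enough.\<close>
    define d where "d = 1 / real (Suc n)"
    have "d > 0" "d < e / 2"
      using n by (simp_all add: d_def)
    have "\<forall>f. \<exists>q. q \<in> \<rat> \<and> \<bar>f x - q\<bar> < d / 2"
    proof
      fix f :: "'a \<Rightarrow> real"
      obtain q where "q \<in> \<rat>" "f x < q" "q < f x + d / 2"
        using Rats_dense_in_real[of "f x" "f x + d / 2"] \<open>d > 0\<close> by auto
      then show "\<exists>q. q \<in> \<rat> \<and> \<bar>f x - q\<bar> < d / 2"
        by (intro exI[of _ q]) auto
    qed
    from choice[OF this] obtain q :: "('a \<Rightarrow> real) \<Rightarrow> real"
      where q: "\<And>f. q f \<in> \<rat>" "\<And>f. \<bar>f x - q f\<bar> < d / 2"
      by blast
    obtain fs where fs: "set fs = S"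
      using S(1) finite_list by blast
    define p where "p = (map (\<lambda>f. (f, q f)) fs, n)"
    let ?V = "\<Inter>f\<in>S. {z. \<bar>f z - f x\<bar> < d / 2}"
    have "open ?V"
      using S A(1) continuous by (intro open_INT ballI open_Collect_less continuous_intros) auto
    moreover have "x \<in> ?V"
      using \<open>d > 0\<close> by simp
    ultimately obtain c where c: "c \<in> c0_points F" "c \<in> ?V"
      using dense open_Int_closure_eq_empty[of ?V "c0_points F"] by blast
    have "\<bar>f c - q f\<bar> < d" if "f \<in> S" for f
    proof -
      have "\<bar>f c - f x\<bar> < d / 2"
        using c(2) that by blast
      then show ?thesis
        using q(2)[of f] by linarith
    qed
    then have "ok p c"
      using c(1) fs by (auto simp: ok_def p_def d_def)
    then have "p \<in> P"
      using S(2) fs q(1) by (auto simp: P_def p_def)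
    have "\<bar>f (pick p) - f x\<bar> < e" if f: "f \<in> S" for f
    proof -
      have "\<bar>f (pick p) - q f\<bar> < d"
        using pick[OF \<open>p \<in> P\<close>] f fs by (auto simp: ok_def p_def d_def)
      then show ?thesis
        using q(2)[of f] \<open>d < e / 2\<close> \<open>d > 0\<close> by linarith
    qed
    then show ?thesis
      using \<open>p \<in> P\<close> by blast
  qed
  moreover have "pick ` P \<subseteq> c0_points F"
    using pick by (auto simp: ok_def)
  ultimately show ?thesis
    unfolding dense_in_coordinates_def by (intro exI[of _ "pick ` P"]) (simp; blast)
qed

text \<open>Closing off: at each step the supports of countably many c_0 points, dense for the
  coordinates reached so far, are added. In the union \<open>A\<close>, any point is approximated on
  finitely many coordinates by c_0 points supported in \<open>A\<close>; the limit of such points is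
  its truncation to \<open>A\<close>.\<close>

lemma ex_good_superset:
  assumes A0: "A0 \<subseteq> F" "countable A0"
  obtains A where "A0 \<subseteq> A" "good A"
proof -
  have "\<forall>A. \<exists>C. A \<subseteq> F \<longrightarrow> countable A \<longrightarrow> C \<subseteq> c0_points F \<and> countable C \<and> dense_in_coordinates A C"
    using ex_countable_dense_in_coordinates by blast
  from choice[OF this] obtain C where "\<forall>A. A \<subseteq> F \<longrightarrow> countable A \<longrightarrow>
      C A \<subseteq> c0_points F \<and> countable (C A) \<and> dense_in_coordinates A (C A)" ..
  then have C: "C A \<subseteq> c0_points F" "countable (C A)" "dense_in_coordinates A (C A)"
    if "A \<subseteq> F" "countable A" for A
    using that by simp_all
  define a where "a n = ((\<lambda>A. A \<union> (\<Union>c\<in>C A. support c)) ^^ n) A0" for n :: nat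
  have a: "a 0 = A0" "a (Suc n) = a n \<union> (\<Union>c\<in>C (a n). support c)" for n
    by (simp_all add: a_def)
  have a_ok: "a n \<subseteq> F \<and> countable (a n)" for n
  proof (induction n)
    case (Suc n)
    then have "countable (\<Union>c\<in>C (a n). support c)"
      using C(1,2) countable_support by (intro countable_UN) blast+
    then show ?case
      using Suc by (auto simp: a support_def)
  qed (use A0 in \<open>simp add: a\<close>)
  have a_mono: "a m \<subseteq> a n" if "m \<le> n" for m n
    using that by (induction rule: dec_induct) (auto simp: a)
  define A where "A = (\<Union>n. a n)"
  have "\<exists>y. \<forall>f\<in>F. f y = (if f \<in> A then f x else 0)" for x
  proof -
    \<comment> \<open>The intersection with \<open>A\<close> matters for empty \<open>A\<close>,
      where \<open>from_nat_into A\<close> takes an unspecified value.\<close>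
    define S where "S n = from_nat_into A ` {..<n} \<inter> A" for n
    have "\<exists>y. (\<forall>f\<in>S n. \<bar>f y - f x\<bar> < 1 / Suc n) \<and> (\<forall>f\<in>F - A. f y = 0)" for n
    proof -
      have S: "finite (S n)" "S n \<subseteq> \<Union>(range a)"
        by (auto simp: S_def A_def)
      then have "\<forall>f. \<exists>k. f \<in> S n \<longrightarrow> f \<in> a k"
        by blast
      from choice[OF this] obtain k where "\<And>f. f \<in> S n \<Longrightarrow> f \<in> a (k f)"
        by blast
      moreover have "k f \<le> Max (k ` S n)" if "f \<in> S n" for f
        using that S(1) by simp
      ultimately have k: "S n \<subseteq> a (Max (k ` S n))"
        using a_mono by blast
      obtain c where c: "c \<in> C (a (Max (k ` S n)))" "\<forall>f\<in>S n. \<bar>f c - f x\<bar> < 1 / Suc n"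
        using C(3)[of "a (Max (k ` S n))"] a_ok S(1) k unfolding dense_in_coordinates_def
        by (metis divide_pos_pos of_nat_0_less_iff zero_less_Suc zero_less_one)
      have "support c \<subseteq> A"
        using c(1) a(2)[of "Max (k ` S n)"] unfolding A_def by blast
      then show ?thesis
        using c(2) by (intro exI[of _ c]) (auto simp: support_def)
    qed
    then obtain y where y: "\<And>n f. f \<in> S n \<Longrightarrow> \<bar>f (y n) - f x\<bar> < 1 / Suc n" "\<And>n f. f \<in> F - A \<Longrightarrow> f (y n) = 0"
      by metis
    have "((\<lambda>n. f (y n)) \<longlongrightarrow> (if f \<in> A then f x else 0)) sequentially" if f: "f \<in> F" for f
    proof (cases "f \<in> A")
      case True
      have "countable A"
        unfolding A_def using a_ok by (intro countable_UN) auto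
      then obtain i where i: "from_nat_into A i = f"
        using from_nat_into_surj True by metis
      have "eventually (\<lambda>n. norm (f (y n) - f x) \<le> 1 / Suc n) sequentially"
        using eventually_gt_at_top[of i]
      proof eventually_elim
        case (elim n)
        then have "f \<in> S n"
          using i True by (auto simp: S_def)
        then show ?case
          using y(1) less_imp_le by (simp only: real_norm_def) blast
      qed
      then have "(\<lambda>n. f (y n) - f x) \<longlonglongrightarrow> 0"
        by (rule Lim_null_comparison) (use LIMSEQ_inverse_real_of_nat in \<open>simp add: inverse_eq_divide\<close>)
      then show ?thesis
        using True by (simp add: LIM_zero_iff)
    next
      case False
      then have "f (y n) = 0" for n
        using y(2)[of f n] f by blast
      then show ?thesis
        using False by simp
    qed
    then obtain l where "\<And>f. f \<in> F \<Longrightarrow> f l = (if f \<in> A then f x else 0)"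
      using tendsto_of_separating_family[where F = F and y = y and c = "\<lambda>f. if f \<in> A then f x else 0",
          OF compact_UNIV sequentially_bot continuous separating] by blast
    then show ?thesis
      by blast
  qed
  moreover have "A \<subseteq> F" "countable A"
    unfolding A_def using a_ok by auto
  ultimately have "good A"
    unfolding good_def by blast
  moreover have "A0 \<subseteq> A"
    unfolding A_def using a(1) by blast
  ultimately show thesis
    using that by blast
qed

lemma proj_of_support:
  assumes "good A" "support x \<subseteq> A"
  shows "proj A x = x"
  using assms by (intro eqI) (auto simp: proj support_def)


section \<open>The directed set of good coordinate sets\<close>

definition index_set :: "('a, 'g) skeleton_index set" where
  "index_set = Inl ` {A. good A}"

definition index_le :: "('a, 'g) skeleton_index rel" where
  "index_le = {(Inl A, Inl B) | A B. good A \<and> good B \<and> A \<subseteq> B}"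

lemma index_le_iff:
  "(s, t) \<in> index_le \<longleftrightarrow> s \<in> index_set \<and> t \<in> index_set \<and> projl s \<subseteq> projl t"
  by (auto simp: index_le_def index_set_def)

lemma good_projl: "s \<in> index_set \<Longrightarrow> good (projl s)"
  by (auto simp: index_set_def)

lemma partial_order_index: "partial_order_on (index_set :: ('a, 'g) skeleton_index set) index_le"
  unfolding partial_order_on_def preorder_on_def
  by (auto simp: refl_on_def trans_def antisym_def index_le_iff index_set_def)

lemma up_directed_index: "up_directed (index_set :: ('a, 'g) skeleton_index set) index_le"
  unfolding up_directed_def
proof (intro conjI ballI)
  obtain A where "good A"
    by (rule ex_good_superset[of "{}"]) auto
  then show "(index_set :: ('a, 'g) skeleton_index set) \<noteq> {}"
    by (auto simp: index_set_def)
  fix s t :: "('a, 'g) skeleton_index" assume st: "s \<in> index_set" "t \<in> index_set"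
  then have "projl s \<union> projl t \<subseteq> F" "countable (projl s \<union> projl t)"
    using good_projl[of s] good_projl[of t] by (auto simp: good_def)
  then obtain A where "projl s \<union> projl t \<subseteq> A" "good A"
    by (rule ex_good_superset)
  then show "\<exists>u\<in>index_set. (s, u) \<in> index_le \<and> (t, u) \<in> index_le"
    using st by (intro bexI[of _ "Inl A"]) (auto simp: index_le_iff index_set_def)
qed

lemma trans_index_le: "trans (index_le :: ('a, 'g) skeleton_index rel)"
  using partial_order_index[where 'g = 'g] by (simp add: partial_order_on_def preorder_on_def)

lemma increasing_index:
  assumes \<sigma>: "increasing_in index_set index_le \<sigma>"
  shows "\<sigma> n \<in> index_set" "m \<le> n \<Longrightarrow> projl (\<sigma> m) \<subseteq> projl (\<sigma> n)"
proof -
  show "\<sigma> n \<in> index_set"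
    using \<sigma> by (simp add: increasing_in_def)
  show "projl (\<sigma> m) \<subseteq> projl (\<sigma> n)" if "m \<le> n"
    using that by (induction rule: dec_induct) (use \<sigma> in \<open>auto simp: increasing_in_def index_le_iff\<close>)
qed

lemma increasing_limit:
  assumes \<sigma>: "increasing_in index_set index_le \<sigma>"
  obtains l where "(\<lambda>n. proj (projl (\<sigma> n)) x) \<longlonglongrightarrow> l"
    "\<And>f. f \<in> F \<Longrightarrow> f l = (if f \<in> (\<Union>n. projl (\<sigma> n)) then f x else 0)"
proof (rule proj_limit[where G = sequentially and M = UNIV and a = "\<lambda>n. projl (\<sigma> n)" and U = "\<Union>n. projl (\<sigma> n)"])
  fix f assume "f \<in> (\<Union>n. projl (\<sigma> n))"
  then obtain m where "f \<in> projl (\<sigma> m)"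
    by blast
  then show "eventually (\<lambda>n. f \<in> projl (\<sigma> n)) sequentially"
    using increasing_index(2)[OF \<sigma>, of m] unfolding eventually_sequentially by blast
qed (use increasing_index(1)[OF \<sigma>] good_projl that in auto)

lemma good_UN_increasing:
  assumes \<sigma>: "increasing_in index_set index_le \<sigma>"
  shows "good (\<Union>n. projl (\<sigma> n))"
  unfolding good_def
proof (intro conjI allI)
  have g: "good (projl (\<sigma> n))" for n
    using increasing_index(1)[OF \<sigma>] by (rule good_projl)
  then show "(\<Union>n. projl (\<sigma> n)) \<subseteq> F" "countable (\<Union>n. projl (\<sigma> n))"
    by (auto simp: good_def)
  show "\<exists>y. \<forall>f\<in>F. f y = (if f \<in> (\<Union>n. projl (\<sigma> n)) then f x else 0)" for x
    by (rule increasing_limit[OF \<sigma>, of x]) blast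
qed

lemma is_supremum_UN:
  assumes \<sigma>: "increasing_in index_set index_le \<sigma>"
  shows "is_supremum index_set index_le (range \<sigma>) (Inl (\<Union>n. projl (\<sigma> n)))"
  using good_UN_increasing[OF \<sigma>] increasing_index(1)[OF \<sigma>]
  by (auto simp: is_supremum_def index_le_iff index_set_def)

lemma is_supremum_projl:
  assumes \<sigma>: "increasing_in index_set index_le \<sigma>"
    and s: "is_supremum index_set index_le (range \<sigma>) s"
  shows "s \<in> index_set" "projl s = (\<Union>n. projl (\<sigma> n))"
proof -
  show "s \<in> index_set"
    using s by (simp add: is_supremum_def)
  have "(s, Inl (\<Union>n. projl (\<sigma> n))) \<in> index_le" "(Inl (\<Union>n. projl (\<sigma> n)), s) \<in> index_le"
    using s is_supremum_UN[OF \<sigma>] by (auto simp: is_supremum_def)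
  then show "projl s = (\<Union>n. projl (\<sigma> n))"
    by (auto simp: index_le_iff)
qed

lemma retractional_skeleton_proj:
  "retractional_skeleton (index_set :: ('a, 'g) skeleton_index set) index_le (\<lambda>s. proj (projl s))"
  unfolding retractional_skeleton_def
proof (intro conjI ballI allI impI)
  show "partial_order_on (index_set :: ('a, 'g) skeleton_index set) index_le"
    "up_directed (index_set :: ('a, 'g) skeleton_index set) index_le"
    by (rule partial_order_index up_directed_index)+
  show "sigma_complete (index_set :: ('a, 'g) skeleton_index set) index_le"
    using is_supremum_UN unfolding sigma_complete_def by blast
next
  fix s :: "('a, 'g) skeleton_index" assume s: "s \<in> index_set"
  show "retraction UNIV (range (proj (projl s))) (proj (projl s))"
    using continuous_proj[OF good_projl[OF s]] proj_proj(1)[OF good_projl[OF s] good_projl[OF s]]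
    by (auto simp: retraction_def)
  show "compact (range (proj (projl s)))" "metrizable_space (top_of_set (range (proj (projl s))))"
    by (rule compact_range_proj metrizable_range_proj, rule good_projl[OF s])+
next
  fix s t :: "('a, 'g) skeleton_index" assume "s \<in> index_set" "t \<in> index_set" "(s, t) \<in> index_le"
  then show "proj (projl s) = proj (projl t) \<circ> proj (projl s)" "proj (projl s) = proj (projl s) \<circ> proj (projl t)"
    using proj_proj[of "projl s" "projl t"] good_projl[of s] good_projl[of t]
    by (auto simp: index_le_iff fun_eq_iff)
next
  fix \<sigma> and s :: "('a, 'g) skeleton_index" and x assume \<sigma>: "increasing_in index_set index_le \<sigma>" and s: "is_supremum index_set index_le (range \<sigma>) s"
  obtain l where l: "(\<lambda>n. proj (projl (\<sigma> n)) x) \<longlonglongrightarrow> l"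
    "\<And>f. f \<in> F \<Longrightarrow> f l = (if f \<in> (\<Union>n. projl (\<sigma> n)) then f x else 0)"
    by (rule increasing_limit[OF \<sigma>, of x]) blast
  have "l = proj (projl s) x"
    using l(2) proj[OF good_projl[OF is_supremum_projl(1)[OF \<sigma> s]]]
    unfolding is_supremum_projl(2)[OF \<sigma> s] by (intro eqI) simp
  then show "(\<lambda>n. proj (projl (\<sigma> n)) x) \<longlonglongrightarrow> proj (projl s) x"
    using l(1) by simp
next
  fix x
  show "((\<lambda>s. proj (projl s) x) \<longlongrightarrow> x) (tails (index_set :: ('a, 'g) skeleton_index set) index_le)"
  proof (rule tendsto_coordinates)
    fix f assume f: "f \<in> F"
    obtain A where A: "{f} \<subseteq> A" "good A"
      by (rule ex_good_superset[of "{f}"]) (use f in auto)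
    have "f (proj (projl t) x) = f x" if "t \<in> index_set" "(Inl A, t) \<in> index_le"
      for t :: "('a, 'g) skeleton_index"
      using that A proj[OF good_projl f, of t x] by (auto simp: index_le_iff)
    then have "eventually (\<lambda>s. f (proj (projl s) x) = f x) (tails (index_set :: ('a, 'g) skeleton_index set) index_le)"
      using A(2) unfolding eventually_tails[OF up_directed_index trans_index_le]
      by (intro bexI[of _ "Inl A"]) (auto simp: index_set_def)
    then show "((\<lambda>s. f (proj (projl s) x)) \<longlongrightarrow> f x)
        (tails (index_set :: ('a, 'g) skeleton_index set) index_le)"
      by (rule tendsto_eventually)
  qed
qed

section \<open>Limits and shrinking at the c_0 points\<close>

lemma c0_points_subset_induced_set:
  "c0_points F \<subseteq> induced_set (index_set :: ('a, 'g) skeleton_index set) (\<lambda>s. proj (projl s))"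
proof
  fix x assume x: "x \<in> c0_points F"
  have "support x \<subseteq> F"
    by (auto simp: support_def)
  then obtain A where A: "support x \<subseteq> A" "good A"
    by (rule ex_good_superset[OF _ countable_support[OF x]])
  then have "x \<in> range (proj A)"
    using proj_of_support by (metis rangeI)
  then show "x \<in> induced_set (index_set :: ('a, 'g) skeleton_index set) (\<lambda>s. proj (projl s))"
    using A(2) by (auto simp: induced_set_def index_set_def)
qed

text \<open>The limit along \<open>M\<close> truncates \<open>x\<close> to the union of the
  coordinate sets, so no coordinate grows in absolute value.\<close>

lemma closed_under_limits_c0_points:
  "closed_under_limits (c0_points F) (index_set :: ('a, 'g) skeleton_index set) index_le (\<lambda>s. proj (projl s))"
  unfolding closed_under_limits_def
proof (intro ballI allI impI)
  fix x and M :: "('a, 'g) skeleton_index set" assume x: "x \<in> c0_points F" and M: "M \<subseteq> index_set" "up_directed M index_le"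
  note ev = eventually_tails[OF M(2) trans_index_le]
  obtain l where l: "((\<lambda>s. proj (projl s) x) \<longlongrightarrow> l) (tails M index_le)"
    "\<And>f. f \<in> F \<Longrightarrow> f l = (if f \<in> (\<Union>s\<in>M. projl s) then f x else 0)"
  proof (rule proj_limit[where G = "tails M index_le" and M = M and a = projl and U = "\<Union>s\<in>M. projl s"])
    show "tails M index_le \<noteq> bot"
      by (rule tails_nontrivial[OF M(2) trans_index_le])
    show "good (projl s)" if "s \<in> M" for s
      using that M(1) good_projl by blast
    show "eventually (\<lambda>s. s \<in> M) (tails M index_le)"
      using M(2) by (auto simp: ev up_directed_def)
    show "eventually (\<lambda>s. f \<in> projl s) (tails M index_le)" if "f \<in> (\<Union>s\<in>M. projl s)" for f
      using that unfolding ev index_le_iff by blast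
  qed (use that in auto)
  have "finite {f \<in> F. \<bar>f l\<bar> > e}" if "e > 0" for e
  proof (rule finite_subset)
    have "\<bar>f l\<bar> \<le> \<bar>f x\<bar>" if "f \<in> F" for f
      using l(2)[OF that] by simp
    then show "{f \<in> F. \<bar>f l\<bar> > e} \<subseteq> {f \<in> F. \<bar>f x\<bar> > e}"
      by (auto intro: less_le_trans)
    show "finite {f \<in> F. \<bar>f x\<bar> > e}"
      using x that by (simp add: c0_points_def)
  qed
  then show "\<exists>l\<in>c0_points F. ((\<lambda>s. proj (projl s) x) \<longlongrightarrow> l) (tails M index_le)"
    using l(1) by (auto simp: c0_points_def)
qed

text \<open>Adding the zero function only serves to make the set nonempty when the space is a singleton.\<close>

definition coordinate_functions :: "('a \<Rightarrow>\<^sub>C real) set" where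
  "coordinate_functions = {g. apply_bcontfun g \<in> insert (\<lambda>_. 0) F}"

lemma coordinate_functions:
  "coordinate_functions \<noteq> {}" "bounded coordinate_functions" "separates_points coordinate_functions"
proof -
  have "0 \<in> coordinate_functions"
    by (simp add: coordinate_functions_def zero_bcontfun.rep_eq)
  then show "coordinate_functions \<noteq> {}"
    by blast
  have "norm g \<le> 2" if "g \<in> coordinate_functions" for g
    using that bounded by (intro norm_bound) (auto simp: coordinate_functions_def)
  then show "bounded coordinate_functions"
    by (auto simp: bounded_iff)
  show "separates_points coordinate_functions"
    unfolding separates_points_def
  proof (intro allI impI)
    fix k l :: 'a assume "k \<noteq> l"
    then obtain f where f: "f \<in> F" "f k \<noteq> f l"
      using separating by blast
    have "f \<in> bcontfun"
      using continuous[OF f(1)] bounded[OF f(1)] by (auto simp: bcontfun_def bounded_iff)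
    then have "apply_bcontfun (Bcontfun f) = f"
      by (rule Bcontfun_inverse)
    then show "\<exists>g\<in>coordinate_functions. apply_bcontfun g k \<noteq> apply_bcontfun g l"
      using f by (intro bexI[of _ "Bcontfun f"]) (auto simp: coordinate_functions_def)
  qed
qed

text \<open>Between stage \<open>n\<close> and the supremum a coordinate \<open>f\<close> changes
  either not at all or by the full amount \<open>\<bar>f x\<bar>\<close>. Only finitely many
  coordinates exceed \<open>e / 2\<close> at \<open>x\<close>, and those that belong to the supremum
  are present from some stage on.\<close>

lemma shrinking_coordinate_functions:
  "shrinking coordinate_functions (c0_points F) (index_set :: ('a, 'g) skeleton_index set) index_le
     (\<lambda>s. proj (projl s))"
  unfolding shrinking_def
proof (intro ballI allI impI)
  fix x \<sigma> and s :: "('a, 'g) skeleton_index" assume x: "x \<in> c0_points F" and \<sigma>: "increasing_in index_set index_le \<sigma>"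
    and s: "is_supremum index_set index_le (range \<sigma>) s"
  let ?\<rho> = "\<lambda>n. rho coordinate_functions (proj (projl (\<sigma> n)) x) (proj (projl s) x)"
  note goods = good_projl[OF increasing_index(1)[OF \<sigma>]] good_projl[OF is_supremum_projl(1)[OF \<sigma> s]]
  show "?\<rho> \<longlonglongrightarrow> 0"
  proof (rule tendstoI)
    fix e :: real assume "e > 0"
    define T where "T = {f \<in> F. \<bar>f x\<bar> > e / 2} \<inter> projl s"
    have "finite {f \<in> F. \<bar>f x\<bar> > e / 2}"
      using x half_gt_zero[OF \<open>e > 0\<close>] unfolding c0_points_def by blast
    then have "finite T"
      by (simp add: T_def)
    moreover have "eventually (\<lambda>n. f \<in> projl (\<sigma> n)) sequentially" if "f \<in> T" for f
    proof -
      from that obtain m where "f \<in> projl (\<sigma> m)"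
        unfolding T_def is_supremum_projl(2)[OF \<sigma> s] by blast
      then show ?thesis
        using increasing_index(2)[OF \<sigma>, of m] unfolding eventually_sequentially by blast
    qed
    ultimately have "eventually (\<lambda>n. \<forall>f\<in>T. f \<in> projl (\<sigma> n)) sequentially"
      by (simp add: eventually_ball_finite)
    then show "eventually (\<lambda>n. dist (?\<rho> n) 0 < e) sequentially"
    proof eventually_elim
      case (elim n)
      have "?\<rho> n \<le> e / 2"
        unfolding rho_def
      proof (rule cSUP_least[OF coordinate_functions(1)])
        fix g assume "g \<in> coordinate_functions"
        then consider "apply_bcontfun g = (\<lambda>_. 0)" | "apply_bcontfun g \<in> F"
          by (auto simp: coordinate_functions_def)
        then show "\<bar>apply_bcontfun g (proj (projl (\<sigma> n)) x) - apply_bcontfun g (proj (projl s) x)\<bar> \<le> e / 2"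
        proof cases
          case 1
          then show ?thesis
            using \<open>e > 0\<close> by simp
        next
          case 2
          have "\<bar>apply_bcontfun g x\<bar> \<le> e / 2" if "apply_bcontfun g \<in> projl s" "apply_bcontfun g \<notin> projl (\<sigma> n)"
            using elim that 2 by (auto simp: T_def)
          moreover have "projl (\<sigma> n) \<subseteq> projl s"
            unfolding is_supremum_projl(2)[OF \<sigma> s] by blast
          ultimately show ?thesis
            using \<open>e > 0\<close> by (auto simp: proj[OF goods(1) 2] proj[OF goods(2) 2])
        qed
      qed
      moreover have "?\<rho> n \<ge> 0"
      proof -
        obtain g where "g \<in> coordinate_functions"
          using coordinate_functions(1) by blast
        then show ?thesis
          using abs_diff_le_rho[OF coordinate_functions(2), of g] abs_ge_zero order_trans by blast
      qed
      ultimately show ?case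
        using \<open>e > 0\<close> by (simp add: dist_real_def)
    qed
  qed
qed

end

section \<open>The equivalence\<close>

lemma semi_Eberlein_imp_shrinking_skeleton:
  assumes K: "compact (UNIV :: 'a::t2_space set)" and "semi_Eberlein TYPE('i) TYPE('a)"
  shows "\<exists>(D :: 'a set) (A :: ('a \<Rightarrow>\<^sub>C real) set) (\<Gamma> :: ('a, 'g) skeleton_index set) le r.
    closure D = UNIV \<and> A \<noteq> {} \<and> bounded A \<and> separates_points A \<and>
    retractional_skeleton \<Gamma> le r \<and> D \<subseteq> induced_set \<Gamma> r \<and>
    shrinking A D \<Gamma> le r \<and> closed_under_limits D \<Gamma> le r"
proof -
  obtain F :: "('a \<Rightarrow> real) set" where F: "dense_c0_family F"
    using assms(2) by (rule semi_EberleinE)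
  interpret c0_family F
    using K F by unfold_locales
  show ?thesis
    by (rule exI[of _ "c0_points F"], rule exI[of _ coordinate_functions], rule exI[of _ index_set],
        rule exI[of _ index_le], rule exI[of _ "\<lambda>s. proj (projl s)"])
      (intro conjI dense coordinate_functions retractional_skeleton_proj c0_points_subset_induced_set
        shrinking_coordinate_functions closed_under_limits_c0_points)
qed

text \<open>The cover is enumerated so that the number of a set can enter the weights of the
  constructed functions. All pairs of points are separated because the limit retraction of the whole
  of \<open>\<Gamma>\<close> is the identity.\<close>

lemma semi_Eberlein_of_eps_shrinking:
  fixes D :: "'a::t2_space set" and \<Gamma> :: "'g set"
  assumes K: "compact (UNIV :: 'a set)" and D: "closure D = UNIV"
    and \<A>: "countable \<A>" "\<forall>A\<in>\<A>. A \<noteq> {} \<and> A \<subseteq> cball 0 1"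
    and skel: "retractional_skeleton \<Gamma> le r"
    and shr: "\<forall>A\<in>\<A>. \<epsilon> A > 0 \<and> eps_shrinking A (\<epsilon> A) D \<Gamma> le r"
    and cover: "\<forall>e>0. cball 0 1 = \<Union>{A \<in> \<A>. \<epsilon> A < e}"
    and lim: "closed_under_limits D \<Gamma> le r"
  shows "semi_Eberlein TYPE(('a, 'i) coord_index) TYPE('a)"
proof -
  interpret skeleton \<Gamma> le r
    using K skel by unfold_locales
  have ex: "\<exists>A\<in>\<A>. g \<in> A \<and> \<epsilon> A < e" if "g \<in> cball 0 1" "e > 0" for g e
    using cover that by blast
  have "(0 :: 'a \<Rightarrow>\<^sub>C real) \<in> cball 0 1"
    by simp
  then have "\<A> \<noteq> {}"
    using ex[OF _ zero_less_one] by blast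
  define A where "A = from_nat_into \<A>"
  have A: "A p \<in> \<A>" for p
    unfolding A_def by (rule from_nat_into[OF \<open>\<A> \<noteq> {}\<close>])
  have "\<exists>F. c0_separating D \<Gamma> F"
  proof (rule ex_c0_separating[OF lim, where A = A and E = "\<lambda>p. \<epsilon> (A p)"])
    fix p
    show "bounded (A p)"
      using \<A>(2) A bounded_cball bounded_subset by metis
    show "eps_shrinking (A p) (\<epsilon> (A p)) D \<Gamma> le r"
      using shr A by blast
  next
    fix g :: "'a \<Rightarrow>\<^sub>C real" and e :: real assume "g \<in> cball 0 1" "0 < e"
    then obtain B where B: "B \<in> \<A>" "g \<in> B" "\<epsilon> B < e"
      using ex by blast
    obtain p where "A p = B"
      using from_nat_into_surj[OF \<A>(1) B(1)] unfolding A_def by blast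
    then show "\<exists>p. g \<in> A p \<and> \<epsilon> (A p) < e"
      using B by blast
  qed
  then obtain F where F: "c0_separating D \<Gamma> F" ..
  have "limit_retraction \<Gamma> x = x" for x
    using skel by (intro limit_retraction_eqI up_directed_carrier) (auto simp: retractional_skeleton_def)
  then have "\<exists>t\<in>\<Gamma>. r t x \<noteq> r t y" if "x \<noteq> y" for x y
    using limit_retraction_eq_iff[OF order_refl up_directed_carrier, of x y] that by auto
  then have "\<exists>f\<in>F. f x \<noteq> f y" if "x \<noteq> y" for x y
    using F that by (simp add: c0_separating_def)
  moreover have "continuous_on UNIV f" "\<bar>f x\<bar> \<le> 2" if "f \<in> F" for f x
  proof -
    show "continuous_on UNIV f"
      using F that by (simp add: c0_separating_def)
    have "\<bar>f x\<bar> \<le> 1"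
      using F that by (simp add: c0_separating_def)
    then show "\<bar>f x\<bar> \<le> 2"
      by simp
  qed
  moreover have "D \<subseteq> c0_points F"
    using F by (auto simp: c0_separating_def c0_points_def)
  then have "closure (c0_points F) = UNIV"
    using D closure_mono[of D "c0_points F"] by auto
  ultimately show ?thesis
    by (intro semi_EberleinI[OF K, of F]) (simp add: dense_c0_family_def)
qed

theorem theorem2:
  assumes "compact (UNIV :: 'a::t2_space set)"
  shows
    "(semi_Eberlein TYPE(('a, 'i) coord_index) TYPE('a) \<longleftrightarrow>
       (\<exists>(D :: 'a set) (A :: ('a \<Rightarrow>\<^sub>C real) set)
          (\<Gamma> :: ('a, 'g) skeleton_index set) le r.
          closure D = UNIV \<and>
          A \<noteq> {} \<and> bounded A \<and> separates_points A \<and>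
          retractional_skeleton \<Gamma> le r \<and> D \<subseteq> induced_set \<Gamma> r \<and>
          shrinking A D \<Gamma> le r \<and>
          closed_under_limits D \<Gamma> le r))
     \<and>
     (semi_Eberlein TYPE(('a, 'i) coord_index) TYPE('a) \<longleftrightarrow>
       (\<exists>(D :: 'a set) (\<A> :: ('a \<Rightarrow>\<^sub>C real) set set)
          (\<Gamma> :: ('a, 'h) skeleton_index set) le r (\<epsilon> :: ('a \<Rightarrow>\<^sub>C real) set \<Rightarrow> real).
          closure D = UNIV \<and>
          countable \<A> \<and> (\<forall>A\<in>\<A>. A \<noteq> {} \<and> A \<subseteq> cball 0 1) \<and>
          retractional_skeleton \<Gamma> le r \<and> D \<subseteq> induced_set \<Gamma> r \<and>
          (\<forall>A\<in>\<A>. \<epsilon> A > 0 \<and> eps_shrinking A (\<epsilon> A) D \<Gamma> le r) \<and>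
          (\<forall>e>0. cball 0 1 = \<Union>{A \<in> \<A>. \<epsilon> A < e}) \<and>
          closed_under_limits D \<Gamma> le r))"
proof (intro conjI iffI)
  assume "semi_Eberlein TYPE(('a, 'i) coord_index) TYPE('a)"
  from semi_Eberlein_imp_shrinking_skeleton[OF assms this, where 'g = 'g]
  show "\<exists>(D :: 'a set) (A :: ('a \<Rightarrow>\<^sub>C real) set) (\<Gamma> :: ('a, 'g) skeleton_index set) le r.
      closure D = UNIV \<and> A \<noteq> {} \<and> bounded A \<and> separates_points A \<and>
      retractional_skeleton \<Gamma> le r \<and> D \<subseteq> induced_set \<Gamma> r \<and>
      shrinking A D \<Gamma> le r \<and> closed_under_limits D \<Gamma> le r" .
next
  assume "\<exists>(D :: 'a set) (A :: ('a \<Rightarrow>\<^sub>C real) set) (\<Gamma> :: ('a, 'g) skeleton_index set) le r.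
      closure D = UNIV \<and> A \<noteq> {} \<and> bounded A \<and> separates_points A \<and>
      retractional_skeleton \<Gamma> le r \<and> D \<subseteq> induced_set \<Gamma> r \<and>
      shrinking A D \<Gamma> le r \<and> closed_under_limits D \<Gamma> le r"
  then obtain D :: "'a set" and A :: "('a \<Rightarrow>\<^sub>C real) set" and \<Gamma> :: "('a, 'g) skeleton_index set" and le r
    where D: "closure D = UNIV" and A: "bounded A" "A \<noteq> {}" "separates_points A"
      and skel: "retractional_skeleton \<Gamma> le r" and shr: "shrinking A D \<Gamma> le r"
      and lim: "closed_under_limits D \<Gamma> le r"
    by (elim exE conjE)
  obtain \<A> \<epsilon> where "countable \<A>" "\<forall>B\<in>\<A>. B \<noteq> {} \<and> B \<subseteq> cball 0 1"
      "\<forall>B\<in>\<A>. \<epsilon> B > 0 \<and> eps_shrinking B (\<epsilon> B) D \<Gamma> le r" "\<forall>e>0. cball 0 1 = \<Union>{B \<in> \<A>. \<epsilon> B < e}"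
    using shrinking_imp_countable_eps_shrinking[OF assms A shr] by (elim exE conjE)
  then show "semi_Eberlein TYPE(('a, 'i) coord_index) TYPE('a)"
    by (rule semi_Eberlein_of_eps_shrinking[OF assms D _ _ skel _ _ lim])
next
  assume "semi_Eberlein TYPE(('a, 'i) coord_index) TYPE('a)"
  \<comment> \<open>The two characterisations have independent index types, so the shrinking
    skeleton is built anew over the type of the second one.\<close>
  from semi_Eberlein_imp_shrinking_skeleton[OF assms this, where 'g = 'h]
  obtain D :: "'a set" and A :: "('a \<Rightarrow>\<^sub>C real) set" and \<Gamma> :: "('a, 'h) skeleton_index set" and le r
    where D: "closure D = UNIV" and A: "bounded A" "A \<noteq> {}" "separates_points A"
      and skel: "retractional_skeleton \<Gamma> le r" "D \<subseteq> induced_set \<Gamma> r" and shr: "shrinking A D \<Gamma> le r"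
      and lim: "closed_under_limits D \<Gamma> le r"
    by (elim exE conjE)
  obtain \<A> \<epsilon> where "countable \<A>" "\<forall>B\<in>\<A>. B \<noteq> {} \<and> B \<subseteq> cball 0 1"
      "\<forall>B\<in>\<A>. \<epsilon> B > 0 \<and> eps_shrinking B (\<epsilon> B) D \<Gamma> le r" "\<forall>e>0. cball 0 1 = \<Union>{B \<in> \<A>. \<epsilon> B < e}"
    using shrinking_imp_countable_eps_shrinking[OF assms A shr] by (elim exE conjE)
  with D skel lim show "\<exists>(D :: 'a set) (\<A> :: ('a \<Rightarrow>\<^sub>C real) set set)
      (\<Gamma> :: ('a, 'h) skeleton_index set) le r (\<epsilon> :: ('a \<Rightarrow>\<^sub>C real) set \<Rightarrow> real).
      closure D = UNIV \<and>
      countable \<A> \<and> (\<forall>A\<in>\<A>. A \<noteq> {} \<and> A \<subseteq> cball 0 1) \<and>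
      retractional_skeleton \<Gamma> le r \<and> D \<subseteq> induced_set \<Gamma> r \<and>
      (\<forall>A\<in>\<A>. \<epsilon> A > 0 \<and> eps_shrinking A (\<epsilon> A) D \<Gamma> le r) \<and>
      (\<forall>e>0. cball 0 1 = \<Union>{A \<in> \<A>. \<epsilon> A < e}) \<and>
      closed_under_limits D \<Gamma> le r"
    by - (rule exI[of _ D], rule exI[of _ \<A>], rule exI[of _ \<Gamma>], rule exI[of _ le],
        rule exI[of _ r], rule exI[of _ \<epsilon>], intro conjI)
next
  assume "\<exists>(D :: 'a set) (\<A> :: ('a \<Rightarrow>\<^sub>C real) set set)
      (\<Gamma> :: ('a, 'h) skeleton_index set) le r (\<epsilon> :: ('a \<Rightarrow>\<^sub>C real) set \<Rightarrow> real).
      closure D = UNIV \<and>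
      countable \<A> \<and> (\<forall>A\<in>\<A>. A \<noteq> {} \<and> A \<subseteq> cball 0 1) \<and>
      retractional_skeleton \<Gamma> le r \<and> D \<subseteq> induced_set \<Gamma> r \<and>
      (\<forall>A\<in>\<A>. \<epsilon> A > 0 \<and> eps_shrinking A (\<epsilon> A) D \<Gamma> le r) \<and>
      (\<forall>e>0. cball 0 1 = \<Union>{A \<in> \<A>. \<epsilon> A < e}) \<and>
      closed_under_limits D \<Gamma> le r"
  then show "semi_Eberlein TYPE(('a, 'i) coord_index) TYPE('a)"
    by (elim exE conjE) (rule semi_Eberlein_of_eps_shrinking[OF assms])
qed

end
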